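(* Let $\Sigma$ be a simplicial fan in $\mathbb{R}^n$ whose support is convex and of full dimension, let $Q\subset\mathbb{R}^n$ be a quasilattice, and let $X_1,\dots,X_d\in Q$ be generators of the $d$ rays of $\Sigma$ (one vector for each ray). Let $X_\Sigma=U_\Sigma/N_{\mathbb{C}}$ be the complex toric quasifold corresponding to the fundamental triple $(\Sigma,Q,\{X_1,\dots,X_d\})$. Then the quadruples $(\mathbb{C}^{I_\sigma},\Gamma_\sigma,V_\sigma,\eta_\sigma)$, with $\sigma$ ranging over the maximal cones of $\Sigma$, form an atlas of complex quasifold charts of $X_\Sigma$ (the generalized canonical atlas), having one chart around each of the fixed points $p_\sigma$ of the action of the quasitorus $\mathbb{C}^n/Q$ (that is, $p_\sigma=\eta_\sigma([0])\in V_\sigma$). Moreover, the transition mappings are written in terms of generalized Laurent monomials, in the following sense: for any two maximal cones $\sigma,\tau$ with $V_\sigma\cap V_\tau\neq\emptyset$ there are vectors $\underline{a}^j=(a_{ij})_{i\in I_\sigma}\in Q_\sigma$, $j\in I_\tau\setminus I_\sigma$, such that $$\eta_\sigma^{-1}\circ\eta_\tau\colon \eta_\tau^{-1}(V_\sigma\cap V_\tau)\longrightarrow\eta_\sigma^{-1}(V_\sigma\cap V_\tau),\qquad [(z_j)_{j\in I_\tau}]\longmapsto[(w_i)_{i\in I_\sigma}],$$ where $$w_i=\prod_{j\in I_\tau\setminus I_\sigma}z_j^{a_{ij}}\ \text{ for } i\in I_\sigma\setminus I_\tau,\qquad w_i=z_i\prod_{j\in I_\tau\setminus I_\sigma}z_j^{a_{ij}}\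 \text{ for } i\in I_\sigma\cap I_\tau .$$
   Context: **Fans.** A fan $\Sigma$ in $\mathbb{R}^n$ is a (finite) collection of strongly convex polyhedral cones such that each nonempty face of a cone in $\Sigma$ is in $\Sigma$, and the intersection of any two cones in $\Sigma$ is a face of each. Maximal cones are the cones of dimension $n$; generating rays are the cones of dimension $1$. The support of $\Sigma$ is the union of its cones. $\Sigma$ is simplicial if each cone is spanned by linearly independent ray generators. For a maximal cone $\sigma$ of a simplicial fan with ray generators $X_1,\dots,X_d$, $I_\sigma\subset\{1,\dots,d\}$ denotes the set of $n$ indices such that $\sigma$ is generated by $X_i$, $i\in I_\sigma$. If the support is convex of full dimension, it is the union of the maximal cones. **Quasilattices and fundamental triples.** A quasilattice in $\mathbb{R}^n$ is the $\mathbb{Z}$-span of a finite subset of $\mathbb{R}^n$ that spans $\mathbb{R}^n$ as a real vector space. The fan is quasirational with respect to $Q$ if $Q$ meets each ray in a nonzero vector; $(\Sigma,Q,\{X_1,\dots,X_d\})$ with ray generators $X_j\in Q$ is called a fundamental triple. **Exponential.** For a finite index set $I$, $\exp\colon\mathbb{C}^I\to(\mathbb{C}^* )^I$ is $(z_i)_{i\in I}\mapsto(e^{2\pi i z_i})_{i\in I}$ (in the exponent $2\pi i$, $i=\sqrt{-1}$); its restriction $\mathbb{R}^I\to(S^1)^I$ is also denoted $\exp$. **The toric quasifold.** Let $\pi\colon\mathbb{R}^d\to\mathbb{R}^n$ be the linear map $e_j\mapsto X_j$, and $\pi_{\mathbb{C}}\colon\mathbb{C}^d\to\mathbb{C}^n$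 its complexification. Put $N_{\mathbb{C}}=\{\exp(Z)\mid Z\in\mathbb{C}^d,\ \pi_{\mathbb{C}}(Z)\in Q\}\subset(\mathbb{C}^* )^d$, which is the kernel of the induced homomorphism $(\mathbb{C}^* )^d=\mathbb{C}^d/\mathbb{Z}^d\to\mathbb{C}^n/Q$. For each maximal cone $\sigma$ put $U_\sigma=\{\underline{z}\in\mathbb{C}^d\mid z_j\neq0 \text{ for } j\notin I_\sigma\}$, and $U_\Sigma=\bigcup_\sigma U_\sigma$ over all maximal cones. $N_{\mathbb{C}}$ acts on $U_\Sigma$ by coordinatewise multiplication and $X_\Sigma=U_\Sigma/N_{\mathbb{C}}$, with the quotient topology. The quasitorus $\mathbb{C}^n/Q\cong(\mathbb{C}^* )^d/N_{\mathbb{C}}$ acts on $X_\Sigma$; its fixed points are exactly the points $p_\sigma=[z_1:\cdots:z_d]$ with $z_j=0$ for $j\in I_\sigma$ and $z_j=1$ for $j\notin I_\sigma$, one for each maximal cone $\sigma$. Square brackets denote classes in quotients. **Charts.** For a maximal cone $\sigma$, let $\pi_\sigma\colon\mathbb{R}^{I_\sigma}\to\mathbb{R}^n$ be the restriction of $\pi$ to $\mathbb{R}^{I_\sigma}=\prod_{i\in I_\sigma}\mathbb{R}e_i$, which is a linear isomorphism. Let $Q_\sigma=\pi_\sigma^{-1}(Q)$, a quasilattice in $\mathbb{R}^{I_\sigma}\cong\mathbb{R}^n$, and $\Gamma_\sigma=\exp(Q_\sigma)$, a countable subgroup of $(S^1)^{I_\sigma}$ acting on $\mathbb{C}^{I_\sigma}\cong\mathbb{C}^n$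 by coordinatewise multiplication. Let $V_\sigma=U_\sigma/N_{\mathbb{C}}\subset X_\Sigma$, and let $\eta_\sigma\colon\mathbb{C}^{I_\sigma}/\Gamma_\sigma\to V_\sigma$ send $[(z_i)_{i\in I_\sigma}]$ to the class of the point of $\mathbb{C}^d$ with coordinates $z_i$ for $i\in I_\sigma$ and $1$ for $i\notin I_\sigma$. **Atlas.** That the quadruples form an atlas of complex quasifold charts means: the sets $V_\sigma$ are open and cover $X_\Sigma$, each $\eta_\sigma$ is a homeomorphism, and the charts are mutually compatible, i.e. whenever $V_\sigma\cap V_\tau\ne\emptyset$, the homeomorphism $\eta_\sigma^{-1}\circ\eta_\tau$ lifts to a biholomorphism between the universal coverings of the preimages of $\eta_\tau^{-1}(V_\sigma\cap V_\tau)$ in $\mathbb{C}^{I_\tau}$ and of $\eta_\sigma^{-1}(V_\sigma\cap V_\tau)$ in $\mathbb{C}^{I_\sigma}$. **Generalized Laurent monomials.** Let $Q'\subset\mathbb{R}^n$ be a quasilattice and $\Gamma=\exp(Q')$. For a set of indices $I$, nonzero complex numbers $z_l$ ($l\in I$), and vectors $\underline{a}^l=(a_{1l},\dots,a_{nl})\in Q'$ ($l\in I$), the terms $\prod_{l\in I}z_l^{a_{jl}}$, $j=1,\dots,n$, are called generalized Laurent monomials. Here, for each $l$, one chooses $\zeta_l\in\mathbb{C}$ with $e^{2\pi i\zeta_l}=z_l$ and sets $z_l^{a}=e^{2\pi i a\zeta_l}$, using the same $\zeta_l$ for all components $j$; changing $\zeta_l$ by an integer $m$ multiplies the vector of monomials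 by $\exp(m\underline{a}^l)\in\Gamma$, so its class modulo $\Gamma$ is well defined. In the claim this is applied with $Q'=Q_\sigma$, $\Gamma=\Gamma_\sigma$ and $I=I_\tau\setminus I_\sigma$; on $\eta_\tau^{-1}(V_\sigma\cap V_\tau)$ one has $z_j\neq0$ for $j\in I_\tau\setminus I_\sigma$. Empty products equal $1$. *)

theory Defs
  imports
    "HOL-Analysis.Analysis"
    "HOL-Computational_Algebra.Group_Closure"
begin

section \<open>Fans\<close>

text \<open>
  The ambient space \<open>\<real>\<^sup>n\<close> is \<open>real ^ 'n\<close>. The cone spanned by \<open>S\<close> is
  \<open>convex_cone hull S\<close> (which is \<open>{0}\<close> for \<open>S = {}\<close>). A cone contains \<open>0\<close>, so its
  dimension is its \<^const>\<open>aff_dim\<close>.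
\<close>

definition polyhedral_cone :: "(real ^ 'n) set \<Rightarrow> bool" where
  "polyhedral_cone C \<longleftrightarrow> (\<exists>S. finite S \<and> C = convex_cone hull S)"

definition strongly_convex :: "(real ^ 'n) set \<Rightarrow> bool" where
  "strongly_convex C \<longleftrightarrow> (\<forall>x. x \<in> C \<and> - x \<in> C \<longrightarrow> x = 0)"

definition fan :: "(real ^ 'n) set set \<Rightarrow> bool" where
  "fan \<Sigma> \<longleftrightarrow>
     finite \<Sigma> \<and>
     (\<forall>\<sigma>\<in>\<Sigma>. polyhedral_cone \<sigma> \<and> strongly_convex \<sigma>) \<and>
     (\<forall>\<sigma>\<in>\<Sigma>. \<forall>F. F face_of \<sigma> \<and> F \<noteq> {} \<longrightarrow> F \<in> \<Sigma>) \<and>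
     (\<forall>\<sigma>\<in>\<Sigma>. \<forall>\<tau>\<in>\<Sigma>. (\<sigma> \<inter> \<tau>) face_of \<sigma> \<and> (\<sigma> \<inter> \<tau>) face_of \<tau>)"

definition support :: "(real ^ 'n) set set \<Rightarrow> (real ^ 'n) set" where
  "support \<Sigma> = \<Union>\<Sigma>"

definition maximal_cones :: "(real ^ 'n) set set \<Rightarrow> (real ^ 'n) set set" where
  "maximal_cones \<Sigma> = {\<sigma>\<in>\<Sigma>. aff_dim \<sigma> = int CARD('n)}"

definition rays :: "(real ^ 'n) set set \<Rightarrow> (real ^ 'n) set set" where
  "rays \<Sigma> = {\<rho>\<in>\<Sigma>. aff_dim \<rho> = 1}"

definition simplicial_fan :: "(real ^ 'n) set set \<Rightarrow> bool" where
  "simplicial_fan \<Sigma> \<longleftrightarrow>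
     (\<forall>\<sigma>\<in>\<Sigma>. \<exists>B. independent B \<and> (\<forall>b\<in>B. convex_cone hull {b} \<in> rays \<Sigma>) \<and>
                  \<sigma> = convex_cone hull B)"

text \<open>
  The index set \<open>{1,\<dots>,d}\<close> is the finite type \<open>'d\<close>; the generators are indexed so that
  each ray has exactly one of them.
\<close>

definition ray_generators :: "(real ^ 'n) set set \<Rightarrow> ('d::finite \<Rightarrow> real ^ 'n) \<Rightarrow> bool" where
  "ray_generators \<Sigma> X \<longleftrightarrow> bij_betw (\<lambda>j. convex_cone hull {X j}) UNIV (rays \<Sigma>)"

definition cone_indices :: "('d::finite \<Rightarrow> real ^ 'n) \<Rightarrow> (real ^ 'n) set \<Rightarrow> 'd set" where
  "cone_indices X \<sigma> = (THE I. card I = CARD('n) \<and> \<sigma> = convex_cone hull (X ` I))"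

section \<open>Quasilattices\<close>

text \<open>\<^const>\<open>group_closure\<close> is the additive subgroup generated by a set, i.e. its \<open>\<int>\<close>-span.\<close>

definition quasilattice :: "(real ^ 'n) set \<Rightarrow> bool" where
  "quasilattice Q \<longleftrightarrow> (\<exists>A. finite A \<and> span A = UNIV \<and> Q = group_closure A)"

definition fundamental_triple ::
  "(real ^ 'n) set set \<Rightarrow> (real ^ 'n) set \<Rightarrow> ('d::finite \<Rightarrow> real ^ 'n) \<Rightarrow> bool" where
  "fundamental_triple \<Sigma> Q X \<longleftrightarrow>
     fan \<Sigma> \<and> quasilattice Q \<and> ray_generators \<Sigma> X \<and> (\<forall>j. X j \<in> Q)"

section \<open>Coordinate subspaces and the exponential\<close>

text \<open>
  For \<open>I \<subseteq> 'd\<close>, the spaces \<open>\<real>\<^sup>I\<close> and \<open>\<complex>\<^sup>I\<close> are the coordinate subspaces of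
  \<open>real ^ 'd\<close> and \<open>complex ^ 'd\<close>. Since \<open>e\<^sup>0 = 1\<close>, \<open>torus_exp\<close> maps \<open>\<complex>\<^sup>I\<close> to the subtorus
  \<open>(\<complex>\<^sup>*)\<^sup>I\<close> of \<open>(\<complex>\<^sup>*)\<^sup>d\<close> whose elements have coordinates \<open>1\<close> outside \<open>I\<close>.
  Multiplication on \<open>complex ^ 'd\<close> is the library's coordinatewise product.
\<close>

definition coord_subspace :: "'d set \<Rightarrow> ('a::zero ^ 'd) set" where
  "coord_subspace I = {z. \<forall>j. j \<notin> I \<longrightarrow> z $ j = 0}"

definition complexify :: "real ^ 'k \<Rightarrow> complex ^ 'k" where
  "complexify x = (\<chi> i. complex_of_real (x $ i))"

definition exp2pi :: "complex \<Rightarrow> complex" where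
  "exp2pi \<zeta> = exp (2 * complex_of_real pi * \<i> * \<zeta>)"

definition torus_exp :: "complex ^ 'd \<Rightarrow> complex ^ 'd" where
  "torus_exp Z = (\<chi> j. exp2pi (Z $ j))"

section \<open>Quotients by group actions\<close>

definition quotient_topology :: "'a topology \<Rightarrow> ('a \<Rightarrow> 'b) \<Rightarrow> 'b topology" where
  "quotient_topology T q =
     topology (\<lambda>V. V \<subseteq> q ` topspace T \<and> openin T {x \<in> topspace T. q x \<in> V})"

lemma openin_quotient_topology:
  "openin (quotient_topology T q) V \<longleftrightarrow>
     V \<subseteq> q ` topspace T \<and> openin T {x \<in> topspace T. q x \<in> V}"
proof -
  have "istopology (\<lambda>V. V \<subseteq> q ` topspace T \<and> openin T {x \<in> topspace T. q x \<in> V})"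
    unfolding istopology_def
  proof (intro conjI allI impI)
    fix A B assume "A \<subseteq> q ` topspace T \<and> openin T {x \<in> topspace T. q x \<in> A}"
      and "B \<subseteq> q ` topspace T \<and> openin T {x \<in> topspace T. q x \<in> B}"
    moreover have "{x \<in> topspace T. q x \<in> A \<inter> B} =
        {x \<in> topspace T. q x \<in> A} \<inter> {x \<in> topspace T. q x \<in> B}"
      by auto
    ultimately show "A \<inter> B \<subseteq> q ` topspace T" "openin T {x \<in> topspace T. q x \<in> A \<inter> B}"
      by auto
  next
    fix K assume K: "\<forall>A\<in>K. A \<subseteq> q ` topspace T \<and> openin T {x \<in> topspace T. q x \<in> A}"
    then show "\<Union>K \<subseteq> q ` topspace T" by blast
    have "{x \<in> topspace T. q x \<in> \<Union>K} = (\<Union>A\<in>K. {x \<in> topspace T. q x \<in> A})"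
      by auto
    then show "openin T {x \<in> topspace T. q x \<in> \<Union>K}"
      using K by auto
  qed
  then show ?thesis
    by (simp add: quotient_topology_def)
qed

lemma topspace_quotient_topology: "topspace (quotient_topology T q) = q ` topspace T"
proof -
  have "{x \<in> topspace T. q x \<in> q ` topspace T} = topspace T"
    by auto
  then have "openin (quotient_topology T q) (q ` topspace T)"
    by (simp add: openin_quotient_topology)
  then show ?thesis
    by (meson openin_quotient_topology openin_subset openin_topspace subset_antisym)
qed

definition orbit :: "(complex ^ 'd) set \<Rightarrow> complex ^ 'd \<Rightarrow> (complex ^ 'd) set" where
  "orbit G z = (\<lambda>g. g * z) ` G"

definition orbit_set :: "(complex ^ 'd) set \<Rightarrow> (complex ^ 'd) set \<Rightarrow> (complex ^ 'd) set set" where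
  "orbit_set M G = orbit G ` M"

definition orbit_space :: "(complex ^ 'd) set \<Rightarrow> (complex ^ 'd) set \<Rightarrow> (complex ^ 'd) set topology" where
  "orbit_space M G = quotient_topology (top_of_set M) (orbit G)"

section \<open>Complex quasifold charts\<close>

text \<open>
  Holomorphic maps in several variables, on a relatively open subset \<open>U\<close> of a coordinate
  subspace: the derivative within \<open>U\<close> exists at each point and is complex linear.
\<close>

definition holomorphic_vec :: "(complex ^ 'd \<Rightarrow> complex ^ 'd) \<Rightarrow> (complex ^ 'd) set \<Rightarrow> bool" where
  "holomorphic_vec f U \<longleftrightarrow>
     (\<forall>z\<in>U. \<exists>L. (f has_derivative L) (at z within U) \<and> (\<forall>c v. L (c *s v) = c *s L v))"

definition universal_covering ::
  "'a::topological_space set \<Rightarrow> ('a \<Rightarrow> 'b) \<Rightarrow> 'b::topological_space set \<Rightarrow> bool" where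
  "universal_covering E p W \<longleftrightarrow> covering_space E p W \<and> simply_connected E"

text \<open>
  A covering \<open>p : E \<rightarrow> W\<close> of a complex manifold \<open>W\<close> carries the complex structure for which \<open>p\<close>
  is locally biholomorphic, so continuous local sections of \<open>p\<close> are local parametrizations
  of \<open>E\<close>. Any structure on \<open>E\<close> inherited from an ambient type is irrelevant, except for its
  topology.
\<close>

definition covering_holomorphic ::
  "'a::topological_space set \<Rightarrow> ('a \<Rightarrow> complex ^ 'd) \<Rightarrow> (complex ^ 'd) set \<Rightarrow>
   'b::topological_space set \<Rightarrow> ('b \<Rightarrow> complex ^ 'd) \<Rightarrow> ('a \<Rightarrow> 'b) \<Rightarrow> bool" where
  "covering_holomorphic E p W E' p' F \<longleftrightarrow>
     continuous_on E F \<and> F ` E \<subseteq> E' \<and>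
     (\<forall>U s. openin (top_of_set W) U \<and> continuous_on U s \<and> s ` U \<subseteq> E \<and> (\<forall>x\<in>U. p (s x) = x)
        \<longrightarrow> holomorphic_vec (p' \<circ> F \<circ> s) U)"

definition covering_biholomorphism ::
  "'a::topological_space set \<Rightarrow> ('a \<Rightarrow> complex ^ 'd) \<Rightarrow> (complex ^ 'd) set \<Rightarrow>
   'b::topological_space set \<Rightarrow> ('b \<Rightarrow> complex ^ 'd) \<Rightarrow> (complex ^ 'd) set \<Rightarrow> ('a \<Rightarrow> 'b) \<Rightarrow> bool" where
  "covering_biholomorphism E p W E' p' W' F \<longleftrightarrow>
     (\<exists>G. homeomorphism E E' F G \<and>
          covering_holomorphic E p W E' p' F \<and> covering_holomorphic E' p' W' E p G)"

text \<open>
  A chart is a quadruple \<open>(M, G, V, \<eta>)\<close>: a complex vector space \<open>M\<close>, a group \<open>G\<close> acting on it,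
  a subset \<open>V\<close> of the quasifold and a map \<open>\<eta> : M/G \<rightarrow> V\<close>.
\<close>

type_synonym ('d, 'p) qchart =
  "(complex ^ 'd) set \<times> (complex ^ 'd) set \<times> 'p set \<times> ((complex ^ 'd) set \<Rightarrow> 'p)"

definition chart_preimage :: "('d::finite, 'p) qchart \<Rightarrow> 'p set \<Rightarrow> (complex ^ 'd) set" where
  "chart_preimage = (\<lambda>(M, G, V, \<eta>) W. {z \<in> M. \<eta> (orbit G z) \<in> W})"

definition chart_inverse :: "('d::finite, 'p) qchart \<Rightarrow> 'p \<Rightarrow> (complex ^ 'd) set" where
  "chart_inverse = (\<lambda>(M, G, V, \<eta>). inv_into (orbit_set M G) \<eta>)"

text \<open>
  \<open>transition c' c\<close> is \<open>\<eta>'\<^sup>-\<^sup>1 \<circ> \<eta>\<close>; it is meant to be applied to classes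
  of points of \<open>chart_preimage c (V \<inter> V')\<close>.
\<close>

definition transition ::
  "('d::finite, 'p) qchart \<Rightarrow> ('d, 'p) qchart \<Rightarrow> (complex ^ 'd) set \<Rightarrow> (complex ^ 'd) set" where
  "transition c' = (\<lambda>(M, G, V, \<eta>) x. chart_inverse c' (\<eta> x))"

text \<open>
  Universal coverings are unique up to isomorphism over the base, so it does not matter which
  ones are used below.
\<close>

definition compatible :: "('d::finite, 'p) qchart \<Rightarrow> ('d, 'p) qchart \<Rightarrow> bool" where
  "compatible c' c \<longleftrightarrow>
     (case (c', c) of ((M', G', V', \<eta>'), (M, G, V, \<eta>)) \<Rightarrow>
        V' \<inter> V \<noteq> {} \<longrightarrow>
        (let W = chart_preimage c (V' \<inter> V); W' = chart_preimage c' (V' \<inter> V) in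
         \<exists>(E :: (complex ^ 'd) set) p (E' :: (complex ^ 'd) set) p' F.
            universal_covering E p W \<and> universal_covering E' p' W' \<and>
            covering_biholomorphism E p W E' p' W' F \<and>
            (\<forall>e\<in>E. orbit G' (p' (F e)) = transition c' c (orbit G (p e)))))"

definition quasifold_atlas :: "'p topology \<Rightarrow> ('d::finite, 'p) qchart set \<Rightarrow> bool" where
  "quasifold_atlas T \<A> \<longleftrightarrow>
     (\<forall>(M, G, V, \<eta>)\<in>\<A>. openin T V \<and> homeomorphic_map (orbit_space M G) (subtopology T V) \<eta>) \<and>
     (\<Union>(M, G, V, \<eta>)\<in>\<A>. V) = topspace T \<and>
     (\<forall>c'\<in>\<A>. \<forall>c\<in>\<A>. compatible c' c)"

section \<open>The toric quasifold\<close>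

definition pi_real :: "('d::finite \<Rightarrow> real ^ 'n) \<Rightarrow> real ^ 'd \<Rightarrow> real ^ 'n" where
  "pi_real X x = (\<Sum>j\<in>UNIV. (x $ j) *\<^sub>R X j)"

definition pi_complex :: "('d::finite \<Rightarrow> real ^ 'n) \<Rightarrow> complex ^ 'd \<Rightarrow> complex ^ 'n" where
  "pi_complex X Z = (\<Sum>j\<in>UNIV. (Z $ j) *s complexify (X j))"

definition N_C :: "(real ^ 'n) set \<Rightarrow> ('d::finite \<Rightarrow> real ^ 'n) \<Rightarrow> (complex ^ 'd) set" where
  "N_C Q X = torus_exp ` {Z. pi_complex X Z \<in> complexify ` Q}"

definition U_cone :: "('d::finite \<Rightarrow> real ^ 'n) \<Rightarrow> (real ^ 'n) set \<Rightarrow> (complex ^ 'd) set" where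
  "U_cone X \<sigma> = {z. \<forall>j. j \<notin> cone_indices X \<sigma> \<longrightarrow> z $ j \<noteq> 0}"

definition U_fan :: "(real ^ 'n) set set \<Rightarrow> ('d::finite \<Rightarrow> real ^ 'n) \<Rightarrow> (complex ^ 'd) set" where
  "U_fan \<Sigma> X = (\<Union>\<sigma>\<in>maximal_cones \<Sigma>. U_cone X \<sigma>)"

definition toric_quasifold ::
  "(real ^ 'n) set set \<Rightarrow> (real ^ 'n) set \<Rightarrow> ('d::finite \<Rightarrow> real ^ 'n) \<Rightarrow> (complex ^ 'd) set topology" where
  "toric_quasifold \<Sigma> Q X = orbit_space (U_fan \<Sigma> X) (N_C Q X)"

text \<open>
  The elements of the quasitorus \<open>\<complex>\<^sup>n/Q\<close> are cosets. The coset \<open>a\<close> corresponds to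
  \<open>{exp Z | \<pi>\<^sub>\<complex>(Z) \<in> a}\<close>, a coset of \<open>N\<^sub>\<complex>\<close> in \<open>(\<complex>\<^sup>*)\<^sup>d\<close>, and acts through the
  elements of the latter.
\<close>

definition quasitorus :: "(real ^ 'n) set \<Rightarrow> (complex ^ 'n) set set" where
  "quasitorus Q = range (\<lambda>w. (\<lambda>q. w + complexify q) ` Q)"

definition quasitorus_act ::
  "('d::finite \<Rightarrow> real ^ 'n) \<Rightarrow> (complex ^ 'n) set \<Rightarrow> (complex ^ 'd) set \<Rightarrow> (complex ^ 'd) set" where
  "quasitorus_act X a c = {torus_exp Z * z | Z z. pi_complex X Z \<in> a \<and> z \<in> c}"

definition fixed_points ::
  "(real ^ 'n) set set \<Rightarrow> (real ^ 'n) set \<Rightarrow> ('d::finite \<Rightarrow> real ^ 'n) \<Rightarrow> (complex ^ 'd) set set" where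
  "fixed_points \<Sigma> Q X =
     {c \<in> topspace (toric_quasifold \<Sigma> Q X). \<forall>a\<in>quasitorus Q. quasitorus_act X a c = c}"

definition p_point ::
  "(real ^ 'n) set \<Rightarrow> ('d::finite \<Rightarrow> real ^ 'n) \<Rightarrow> (real ^ 'n) set \<Rightarrow> (complex ^ 'd) set" where
  "p_point Q X \<sigma> = orbit (N_C Q X) (\<chi> j. if j \<in> cone_indices X \<sigma> then 0 else 1)"

section \<open>The canonical charts\<close>

definition Q_cone ::
  "(real ^ 'n) set \<Rightarrow> ('d::finite \<Rightarrow> real ^ 'n) \<Rightarrow> (real ^ 'n) set \<Rightarrow> (real ^ 'd) set" where
  "Q_cone Q X \<sigma> = {x \<in> coord_subspace (cone_indices X \<sigma>). pi_real X x \<in> Q}"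

definition Gamma_cone ::
  "(real ^ 'n) set \<Rightarrow> ('d::finite \<Rightarrow> real ^ 'n) \<Rightarrow> (real ^ 'n) set \<Rightarrow> (complex ^ 'd) set" where
  "Gamma_cone Q X \<sigma> = (\<lambda>x. torus_exp (complexify x)) ` Q_cone Q X \<sigma>"

definition V_cone ::
  "(real ^ 'n) set \<Rightarrow> ('d::finite \<Rightarrow> real ^ 'n) \<Rightarrow> (real ^ 'n) set \<Rightarrow> (complex ^ 'd) set set" where
  "V_cone Q X \<sigma> = orbit_set (U_cone X \<sigma>) (N_C Q X)"

text \<open>
  The map induced by \<open>z \<mapsto> [z extended by 1]\<close> on classes: as usual for maps on quotients,
  it is written as the union of the values on all representatives, which is the common value
  once the map is known to be well defined.
\<close>

definition eta_cone ::
  "(real ^ 'n) set \<Rightarrow> ('d::finite \<Rightarrow> real ^ 'n) \<Rightarrow> (real ^ 'n) set \<Rightarrow> (complex ^ 'd) set \<Rightarrow> (complex ^ 'd) set" where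
  "eta_cone Q X \<sigma> c =
     (\<Union>z\<in>c. orbit (N_C Q X) (\<chi> j. if j \<in> cone_indices X \<sigma> then z $ j else 1))"

definition canonical_chart ::
  "(real ^ 'n) set \<Rightarrow> ('d::finite \<Rightarrow> real ^ 'n) \<Rightarrow> (real ^ 'n) set \<Rightarrow> ('d, (complex ^ 'd) set) qchart" where
  "canonical_chart Q X \<sigma> =
     (coord_subspace (cone_indices X \<sigma>), Gamma_cone Q X \<sigma>, V_cone Q X \<sigma>, eta_cone Q X \<sigma>)"

text \<open>
  The product over \<open>j \<in> J\<close> of the powers of \<open>z\<^sub>j\<close> with real exponents \<open>a j $ i\<close>, computed from
  chosen \<open>\<zeta>\<^sub>j\<close> with \<open>exp2pi \<zeta>\<^sub>j = z\<^sub>j\<close>.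
\<close>

definition laurent_monomial ::
  "'d set \<Rightarrow> ('d \<Rightarrow> real ^ 'd) \<Rightarrow> ('d \<Rightarrow> complex) \<Rightarrow> 'd::finite \<Rightarrow> complex" where
  "laurent_monomial J a \<zeta> i = (\<Prod>j\<in>J. exp2pi (complex_of_real (a j $ i) * \<zeta> j))"

end

(* For a maximal cone with index set I, the complexified linear map restricts to an isomorphism on
   C^I, so every Z in C^d has a unique R(Z) in C^I with the same image, and exp(R(Z) - Z) lies in N.
   Multiplying by this element, with Z a vector of logarithms of the coordinates outside I, moves any
   point of U_I to one whose coordinates outside I are 1.  As a function of logarithms this is a
   globally defined continuous map.  It shows that the charts are homeomorphisms, because
   coordinatewise exponentials are coverings and hence open maps.  For coordinates coming from a
   second cone it is the biholomorphism between the universal coverings that lifts the transition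
   map, and its exponents are the coordinates of the X_j in the basis (X_i), i in I. *)
theory Submission
  imports Defs
begin

section \<open>The exponential and group actions\<close>

text \<open>The groups Gamma can be dense in the compact torus, so the projections to the orbit
  spaces need not be coverings and the quotients need not be Hausdorff. Claims about classes are
  therefore turned into claims about points of C^I and C^d (\<open>orbit_ext_one_eq_iff\<close>,
  \<open>open_orbit_preimage_iff\<close>, \<open>orbit_cone_transition\<close>). Injectivity of the
  charts rests on the identity of Gamma with the elements of N whose coordinates outside I are 1.
  The coordinates in both index sets may vanish and have no logarithms; hence the lifted transition
  is additive on some coordinates and multiplicative on the others. The normalization of points of
  U_I is the same lift, with the full set of indices as second index set. Fixed points are detected
  by moduli: Gamma consists of vectors with entries of modulus 1, whereas the quasitorus can rescale
  a coordinate. Finally, the index set of a cone is given by a definite description; its uniqueness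
  comes from the faces of the cone.\<close>

lemma exp2pi_add: "exp2pi (a + b) = exp2pi a * exp2pi b"
  by (simp add: exp2pi_def distrib_left exp_add)

lemma exp2pi_0 [simp]: "exp2pi 0 = 1"
  by (simp add: exp2pi_def)

lemma exp2pi_nonzero [simp]: "exp2pi a \<noteq> 0"
  by (simp add: exp2pi_def)

lemma exp2pi_minus: "exp2pi (- a) = inverse (exp2pi a)"
  by (simp add: exp2pi_def exp_minus)

lemma exp2pi_sum: "exp2pi (sum f A) = (\<Prod>x\<in>A. exp2pi (f x))"
  by (induction A rule: infinite_finite_induct) (simp_all add: exp2pi_add)

lemma exp2pi_eq_1_iff: "exp2pi a = 1 \<longleftrightarrow> (\<exists>m. a = of_int m)"
proof
  assume "exp2pi a = 1"
  then obtain m :: int where "Im a = 0" "2 * pi * Re a = 2 * of_int m * pi"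
    by (auto simp: exp2pi_def exp_eq_1)
  then show "\<exists>m. a = of_int m"
    by (auto simp: complex_eq_iff)
next
  assume "\<exists>m. a = of_int m"
  then show "exp2pi a = 1"
    by (auto simp: exp2pi_def exp_eq_1)
qed

lemma torus_exp_nth [simp]: "torus_exp Z $ j = exp2pi (Z $ j)"
  by (simp add: torus_exp_def)

lemma torus_exp_add: "torus_exp (Z + W) = torus_exp Z * torus_exp W"
  by (simp add: vec_eq_iff exp2pi_add)

lemma torus_exp_0 [simp]: "torus_exp 0 = 1"
  by (simp add: vec_eq_iff)

text \<open>A vector with a zero coordinate has no inverse, so subgroups are described as sets
  closed under products in which each element has an inverse inside the set.\<close>

definition mult_subgroup :: "(complex ^ 'd) set \<Rightarrow> bool" where
  "mult_subgroup G \<longleftrightarrow>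
     1 \<in> G \<and> (\<forall>g\<in>G. \<forall>h\<in>G. g * h \<in> G) \<and> (\<forall>g\<in>G. \<exists>h\<in>G. h * g = 1)"

lemma mult_subgroup_torus_exp_image:
  assumes "0 \<in> S" and "\<And>Z W. Z \<in> S \<Longrightarrow> W \<in> S \<Longrightarrow> Z - W \<in> S"
  shows "mult_subgroup (torus_exp ` S)"
proof -
  have minus: "- Z \<in> S" if "Z \<in> S" for Z
    using assms(2)[OF assms(1) that] by simp
  have add: "Z + W \<in> S" if "Z \<in> S" "W \<in> S" for Z W
    using assms(2)[OF that(1) minus[OF that(2)]] by simp
  show ?thesis
    unfolding mult_subgroup_def
  proof (intro conjI ballI)
    show "1 \<in> torus_exp ` S"
      using assms(1) by (metis image_eqI torus_exp_0)
    show "g * h \<in> torus_exp ` S" if "g \<in> torus_exp ` S" "h \<in> torus_exp ` S" for g h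
      using that add by (auto simp flip: torus_exp_add)
    show "\<exists>h\<in>torus_exp ` S. h * g = 1" if g: "g \<in> torus_exp ` S" for g
    proof -
      obtain Z where "Z \<in> S" "g = torus_exp Z"
        using g by auto
      then have "torus_exp (- Z) * g = 1" "- Z \<in> S"
        using minus by (simp_all flip: torus_exp_add)
      then show ?thesis by blast
    qed
  qed
qed

lemma mem_orbit_iff: "w \<in> orbit G z \<longleftrightarrow> (\<exists>g\<in>G. w = g * z)"
  by (auto simp: orbit_def)

lemma orbit_refl: "mult_subgroup G \<Longrightarrow> z \<in> orbit G z"
  unfolding mem_orbit_iff mult_subgroup_def by (metis mult_1)

lemma orbit_eqI:
  assumes G: "mult_subgroup G" and "g \<in> G"
  shows "orbit G (g * z) = orbit G z"
proof -
  obtain h where h: "h \<in> G" "h * g = 1"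
    using assms by (auto simp: mult_subgroup_def)
  have "orbit G (g * z) \<subseteq> orbit G z"
    using assms unfolding mem_orbit_iff subset_iff mult_subgroup_def by (metis mult.assoc)
  moreover have "k * z \<in> orbit G (g * z)" if "k \<in> G" for k
  proof -
    have "k * z = (k * h) * (g * z)"
      using h(2) by (metis mult.assoc mult.right_neutral)
    moreover have "k * h \<in> G"
      using G h that by (simp add: mult_subgroup_def)
    ultimately show ?thesis
      by (auto simp: mem_orbit_iff)
  qed
  then have "orbit G z \<subseteq> orbit G (g * z)"
    by (auto simp: orbit_def)
  ultimately show ?thesis by blast
qed

lemma orbit_eq_iff:
  assumes "mult_subgroup G"
  shows "orbit G w = orbit G z \<longleftrightarrow> (\<exists>g\<in>G. w = g * z)"
  using assms by (metis mem_orbit_iff orbit_eqI orbit_refl)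

section \<open>Coordinates with respect to a simplicial cone\<close>

definition coord_restrict :: "'d set \<Rightarrow> 'a::zero ^ 'd \<Rightarrow> 'a ^ 'd" where
  "coord_restrict I z = (\<chi> j. if j \<in> I then z $ j else 0)"

definition ext_one :: "'d set \<Rightarrow> complex ^ 'd \<Rightarrow> complex ^ 'd" where
  "ext_one I z = (\<chi> j. if j \<in> I then z $ j else 1)"

text \<open>The vectors X_i with i in I form a basis. This is encoded as bijectivity of the map
  pi_sigma, the form in which it is used below; \<open>basis_onI\<close> derives it from a dimension
  count.\<close>

definition basis_on :: "('d::finite \<Rightarrow> real ^ 'n) \<Rightarrow> 'd set \<Rightarrow> bool" where
  "basis_on X I \<longleftrightarrow> bij_betw (pi_real X) (coord_subspace I) UNIV"

definition coord_rep :: "('d::finite \<Rightarrow> real ^ 'n) \<Rightarrow> 'd set \<Rightarrow> 'd \<Rightarrow> real ^ 'd" where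
  "coord_rep X I j = inv_into (coord_subspace I) (pi_real X) (X j)"

text \<open>The projection of \<open>\<complex>\<^sup>d\<close> onto \<open>\<complex>\<^sup>I\<close> along the kernel of \<open>\<pi>\<^sub>\<complex>\<close>.\<close>

definition cone_proj :: "('d::finite \<Rightarrow> real ^ 'n) \<Rightarrow> 'd set \<Rightarrow> complex ^ 'd \<Rightarrow> complex ^ 'd" where
  "cone_proj X I Z = (\<Sum>j\<in>UNIV. Z $ j *s complexify (coord_rep X I j))"

lemma coord_restrict_nth [simp]: "coord_restrict I z $ j = (if j \<in> I then z $ j else 0)"
  by (simp add: coord_restrict_def)

lemma ext_one_nth [simp]: "ext_one I z $ j = (if j \<in> I then z $ j else 1)"
  by (simp add: ext_one_def)

lemma complexify_nth [simp]: "complexify x $ i = complex_of_real (x $ i)"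
  by (simp add: complexify_def)

lemma complexify_diff: "complexify (x - y) = complexify x - complexify y"
  by (simp add: vec_eq_iff)

lemma coord_subspace_iff: "z \<in> coord_subspace I \<longleftrightarrow> (\<forall>j. j \<notin> I \<longrightarrow> z $ j = 0)"
  by (simp add: coord_subspace_def)

lemma coord_subspaceD: "z \<in> coord_subspace I \<Longrightarrow> j \<notin> I \<Longrightarrow> z $ j = 0"
  by (simp add: coord_subspace_iff)

lemma coord_subspace_diff:
  fixes z w :: "complex ^ 'd"
  assumes "z \<in> coord_subspace I" "w \<in> coord_subspace I"
  shows "z - w \<in> coord_subspace I"
  using assms by (simp add: coord_subspace_iff)

lemma pi_complex_add: "pi_complex X (Z + W) = pi_complex X Z + pi_complex X W"
  by (simp add: pi_complex_def vec_eq_iff sum.distrib algebra_simps)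

lemma pi_complex_diff: "pi_complex X (Z - W) = pi_complex X Z - pi_complex X W"
  by (simp add: pi_complex_def vec_eq_iff sum_subtractf algebra_simps)

lemma pi_complex_0 [simp]: "pi_complex X 0 = 0"
  by (simp add: pi_complex_def)

lemma pi_complex_complexify: "pi_complex X (complexify x) = complexify (pi_real X x)"
  by (simp add: pi_complex_def pi_real_def vec_eq_iff)

lemma pi_real_0 [simp]: "pi_real X 0 = 0"
  by (simp add: pi_real_def)

lemma pi_real_Re: "pi_real X (\<chi> j. Re (Z $ j)) = (\<chi> i. Re (pi_complex X Z $ i))"
  by (simp add: pi_complex_def pi_real_def vec_eq_iff)

lemma pi_real_Im: "pi_real X (\<chi> j. Im (Z $ j)) = (\<chi> i. Im (pi_complex X Z $ i))"
  by (simp add: pi_complex_def pi_real_def vec_eq_iff)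

lemma basis_on_inj:
  assumes "basis_on X I" "x \<in> coord_subspace I" "y \<in> coord_subspace I" "pi_real X x = pi_real X y"
  shows "x = y"
  using assms unfolding basis_on_def bij_betw_def by (meson inj_onD)

text \<open>The map pi_C has real coefficients and so treats real and imaginary parts separately.
  The imaginary part of \<open>Z\<close> is sent to 0 and vanishes by injectivity on R^I. This is
  what puts Gamma into the compact torus.\<close>

lemma basis_on_real_preimage:
  fixes Z :: "complex ^ 'd"
  assumes I: "basis_on X I" and Z: "Z \<in> coord_subspace I" and q: "pi_complex X Z = complexify q"
  obtains x where "x \<in> coord_subspace I" "Z = complexify x" "pi_real X x = q"
proof
  let ?x = "\<chi> j. Re (Z $ j)"
  show "?x \<in> coord_subspace I"
    using Z by (simp add: coord_subspace_iff)
  have "(\<chi> j. Im (Z $ j)) = (0 :: real ^ 'd)"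
  proof (rule basis_on_inj[OF I])
    show "(\<chi> j. Im (Z $ j)) \<in> coord_subspace I"
      using Z by (simp add: coord_subspace_iff)
    show "pi_real X (\<chi> j. Im (Z $ j)) = pi_real X 0"
      unfolding pi_real_Im q by (simp add: vec_eq_iff)
  qed (simp add: coord_subspace_iff)
  then show "Z = complexify ?x"
    by (simp add: vec_eq_iff complex_eq_iff)
  show "pi_real X ?x = q"
    unfolding pi_real_Re q by (simp add: vec_eq_iff)
qed

lemma basis_on_complex_inj:
  assumes I: "basis_on X I" and "Z \<in> coord_subspace I" "W \<in> coord_subspace I"
    and "pi_complex X Z = pi_complex X W"
  shows "Z = W"
proof -
  have "pi_complex X (Z - W) = complexify 0"
    using assms by (simp add: pi_complex_diff vec_eq_iff)
  then obtain x where "x \<in> coord_subspace I" "Z - W = complexify x" "pi_real X x = 0"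
    using basis_on_real_preimage[OF I] assms(2,3) coord_subspace_diff by metis
  moreover from this have "x = 0"
    using basis_on_inj[OF I, of x 0] by (simp add: coord_subspace_iff)
  ultimately show ?thesis
    by (simp add: vec_eq_iff)
qed

lemma coord_rep_mem: "basis_on X I \<Longrightarrow> coord_rep X I j \<in> coord_subspace I"
  unfolding coord_rep_def basis_on_def bij_betw_def by (simp add: inv_into_into)

lemma pi_real_coord_rep: "basis_on X I \<Longrightarrow> pi_real X (coord_rep X I j) = X j"
  unfolding coord_rep_def basis_on_def bij_betw_def by (simp add: f_inv_into_f)

lemma cone_proj_nth: "cone_proj X I Z $ i = (\<Sum>j\<in>UNIV. complex_of_real (coord_rep X I j $ i) * Z $ j)"
  by (simp add: cone_proj_def mult.commute)

lemma cone_proj_mem: "basis_on X I \<Longrightarrow> cone_proj X I Z \<in> coord_subspace I"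
  by (simp add: coord_subspace_iff cone_proj_nth coord_subspaceD[OF coord_rep_mem])

lemma cone_proj_diff: "cone_proj X I (Z - W) = cone_proj X I Z - cone_proj X I W"
  by (simp add: vec_eq_iff cone_proj_nth sum_subtractf algebra_simps)

lemma pi_complex_cone_proj:
  assumes "basis_on X I"
  shows "pi_complex X (cone_proj X I Z) = pi_complex X Z"
proof -
  have lin: "pi_complex X (\<Sum>j\<in>A. Z $ j *s complexify (c j)) =
      (\<Sum>j\<in>A. Z $ j *s complexify (pi_real X (c j)))" for A c
  proof (induction A rule: infinite_finite_induct)
    case (insert j A)
    have "pi_complex X (Z $ j *s complexify (c j)) = Z $ j *s pi_complex X (complexify (c j))"
      by (simp add: pi_complex_def vec_eq_iff sum_distrib_left mult.assoc)
    with insert show ?case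
      by (simp add: pi_complex_add pi_complex_complexify)
  qed simp_all
  show ?thesis
    unfolding cone_proj_def lin by (simp add: pi_real_coord_rep[OF assms] pi_complex_def)
qed

lemma cone_proj_id:
  assumes "basis_on X I" "Z \<in> coord_subspace I"
  shows "cone_proj X I Z = Z"
  using basis_on_complex_inj[OF assms(1) cone_proj_mem[OF assms(1)] assms(2)]
    pi_complex_cone_proj[OF assms(1)] by blast

text \<open>Both sides lie in C^I and have the same image under pi_C, because the projections
  preserve that image.\<close>

lemma cone_proj_cone_proj:
  assumes "basis_on X I" "basis_on X J"
  shows "cone_proj X I (cone_proj X J Z) = cone_proj X I Z"
  using basis_on_complex_inj[OF assms(1) cone_proj_mem[OF assms(1)] cone_proj_mem[OF assms(1)]]
    pi_complex_cone_proj assms by metis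

section \<open>The groups acting\<close>

locale quasilattice_vectors =
  fixes Q :: "(real ^ 'n) set" and X :: "'d::finite \<Rightarrow> real ^ 'n"
  assumes zero_mem: "0 \<in> Q"
    and diff_mem: "\<And>p q. p \<in> Q \<Longrightarrow> q \<in> Q \<Longrightarrow> p - q \<in> Q"
    and vector_mem: "\<And>j. X j \<in> Q"
begin

lemma minus_mem: "q \<in> Q \<Longrightarrow> - q \<in> Q"
  using diff_mem[OF zero_mem] by force

lemma add_mem: "p \<in> Q \<Longrightarrow> q \<in> Q \<Longrightarrow> p + q \<in> Q"
  using diff_mem minus_mem by force

lemma scale_nat_mem: "q \<in> Q \<Longrightarrow> real k *\<^sub>R q \<in> Q"
  by (induction k) (simp_all add: zero_mem add_mem algebra_simps)

lemma scale_int_mem: "q \<in> Q \<Longrightarrow> of_int m *\<^sub>R q \<in> Q"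
  using scale_nat_mem[of q] minus_mem by (cases m rule: int_cases2) fastforce+

lemma sum_mem: "(\<And>x. x \<in> A \<Longrightarrow> f x \<in> Q) \<Longrightarrow> sum f A \<in> Q"
  by (induction A rule: infinite_finite_induct) (simp_all add: zero_mem add_mem)

lemma mult_subgroup_N: "mult_subgroup (N_C Q X)"
  unfolding N_C_def
proof (rule mult_subgroup_torus_exp_image)
  show "0 \<in> {Z. pi_complex X Z \<in> complexify ` Q}"
    using zero_mem by (auto simp: vec_eq_iff image_iff intro!: bexI[of _ 0])
  show "Z - W \<in> {Z. pi_complex X Z \<in> complexify ` Q}"
    if "Z \<in> {Z. pi_complex X Z \<in> complexify ` Q}" "W \<in> {Z. pi_complex X Z \<in> complexify ` Q}" for Z W
    using that diff_mem by (auto simp: pi_complex_diff simp flip: complexify_diff)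
qed

lemma mem_N_iff: "g \<in> N_C Q X \<longleftrightarrow> (\<exists>Z q. g = torus_exp Z \<and> q \<in> Q \<and> pi_complex X Z = complexify q)"
  by (auto simp: N_C_def)

lemma torus_exp_kernel_mem: "pi_complex X Z = 0 \<Longrightarrow> torus_exp Z \<in> N_C Q X"
  unfolding mem_N_iff using zero_mem by (intro exI[of _ Z] exI[of _ 0]) (simp add: vec_eq_iff)

lemma N_nonzero: "g \<in> N_C Q X \<Longrightarrow> g $ j \<noteq> 0"
  by (auto simp: N_C_def)

text \<open>The charts are built for index sets instead of cones; the theorem finally inserts the
  index sets of the maximal cones.\<close>

definition Gamma_on :: "'d set \<Rightarrow> (complex ^ 'd) set" where
  "Gamma_on I = (\<lambda>x. torus_exp (complexify x)) ` {x \<in> coord_subspace I. pi_real X x \<in> Q}"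

text \<open>If exp(Z) is 1 outside \<open>I\<close>, the entries of Z there are integers.
  Subtracting this integer vector leaves exp(Z) unchanged and alters pi_C(Z) by an integer
  combination of the X_j, hence by an element of \<open>Q\<close>. The remaining vector lies in C^I
  and has a real image, so it is real.\<close>

lemma Gamma_on_eq:
  assumes I: "basis_on X I"
  shows "Gamma_on I = {g \<in> N_C Q X. \<forall>j. j \<notin> I \<longrightarrow> g $ j = 1}"
proof (intro equalityI subsetI)
  fix g assume "g \<in> Gamma_on I"
  then show "g \<in> {g \<in> N_C Q X. \<forall>j. j \<notin> I \<longrightarrow> g $ j = 1}"
    by (auto simp: Gamma_on_def N_C_def pi_complex_complexify coord_subspaceD)
next
  fix g assume "g \<in> {g \<in> N_C Q X. \<forall>j. j \<notin> I \<longrightarrow> g $ j = 1}"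
  then obtain Z q where g: "g = torus_exp Z" and q: "q \<in> Q" "pi_complex X Z = complexify q"
    and one: "\<And>j. j \<notin> I \<Longrightarrow> exp2pi (Z $ j) = 1"
    by (auto simp: mem_N_iff)
  obtain m where m: "\<And>j. j \<notin> I \<Longrightarrow> Z $ j = of_int (m j)"
    using one unfolding exp2pi_eq_1_iff by metis
  define k :: "real ^ 'd" where "k = (\<chi> j. if j \<in> I then 0 else of_int (m j))"
  have "pi_real X k \<in> Q"
    unfolding pi_real_def by (rule sum_mem) (simp add: k_def scale_int_mem vector_mem zero_mem)
  then have qk: "q - pi_real X k \<in> Q"
    using q(1) diff_mem by simp
  have "pi_complex X (Z - complexify k) = complexify (q - pi_real X k)"
    by (simp add: pi_complex_diff q(2) pi_complex_complexify complexify_diff)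
  moreover have "Z - complexify k \<in> coord_subspace I"
    by (simp add: coord_subspace_iff k_def m)
  ultimately obtain x where x: "x \<in> coord_subspace I" "Z - complexify k = complexify x"
      "pi_real X x = q - pi_real X k"
    using basis_on_real_preimage[OF I] by metis
  have "torus_exp (complexify k) = 1"
    by (auto simp: vec_eq_iff k_def exp2pi_eq_1_iff)
  then have "g = torus_exp (complexify x)"
    unfolding g x(2)[symmetric] using torus_exp_add[of "Z - complexify k" "complexify k"] by simp
  then show "g \<in> Gamma_on I"
    using x qk by (auto simp: Gamma_on_def)
qed

lemma mult_subgroup_Gamma:
  assumes "basis_on X I"
  shows "mult_subgroup (Gamma_on I)"
  unfolding mult_subgroup_def Gamma_on_eq[OF assms]
proof (intro conjI ballI)
  show "\<exists>h\<in>{g \<in> N_C Q X. \<forall>j. j \<notin> I \<longrightarrow> g $ j = 1}. h * g = 1"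
    if g: "g \<in> {g \<in> N_C Q X. \<forall>j. j \<notin> I \<longrightarrow> g $ j = 1}" for g
  proof -
    obtain h where h: "h \<in> N_C Q X" "h * g = 1"
      using g mult_subgroup_N unfolding mult_subgroup_def by blast
    have "h $ j = 1" if "j \<notin> I" for j
    proof -
      have "h $ j * g $ j = 1"
        using h(2) by (simp add: vec_eq_iff)
      then show ?thesis
        using that g by simp
    qed
    then show ?thesis using h by auto
  qed
qed (use mult_subgroup_N in \<open>auto simp: mult_subgroup_def\<close>)

lemma ext_one_Gamma:
  assumes "basis_on X I" "g \<in> Gamma_on I"
  shows "ext_one I (g * z) = g * ext_one I z"
  using assms by (simp add: Gamma_on_eq vec_eq_iff)

text \<open>An element of N relating two points with all coordinates outside \<open>I\<close> equal
  to 1 must itself be 1 there, so it belongs to Gamma. This yields the injectivity of the chart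
  maps.\<close>

lemma orbit_ext_one_eq_iff:
  assumes I: "basis_on X I" and "z \<in> coord_subspace I" "w \<in> coord_subspace I"
  shows "orbit (N_C Q X) (ext_one I z) = orbit (N_C Q X) (ext_one I w) \<longleftrightarrow>
         orbit (Gamma_on I) z = orbit (Gamma_on I) w"
  unfolding orbit_eq_iff[OF mult_subgroup_N] orbit_eq_iff[OF mult_subgroup_Gamma[OF I]]
proof
  assume "\<exists>g\<in>N_C Q X. ext_one I z = g * ext_one I w"
  then obtain g where g: "g \<in> N_C Q X" "ext_one I z = g * ext_one I w" by blast
  then have nth: "ext_one I z $ j = g $ j * ext_one I w $ j" for j
    by simp
  have "z $ j = g $ j * w $ j" for j
    using nth[of j] assms(2,3) by (cases "j \<in> I") (simp_all add: coord_subspaceD)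
  moreover have "g $ j = 1" if "j \<notin> I" for j
    using nth[of j] that by simp
  ultimately show "\<exists>g\<in>Gamma_on I. z = g * w"
    using g(1) unfolding Gamma_on_eq[OF I] by (intro bexI[of _ g]) (simp_all add: vec_eq_iff)
next
  assume "\<exists>g\<in>Gamma_on I. z = g * w"
  then obtain g where g: "g \<in> Gamma_on I" "z = g * w" by blast
  then have "ext_one I z = g * ext_one I w" "g \<in> N_C Q X"
    using ext_one_Gamma[OF I] Gamma_on_eq[OF I] by blast+
  then show "\<exists>g\<in>N_C Q X. ext_one I z = g * ext_one I w" by blast
qed

end

section \<open>The universal covering of a punctured coordinate subspace\<close>

text \<open>The principal branch. Multiplication by 2 pi i turns the strip of real parts between
  -1/2 and 1/2 into the strip where \<open>Ln\<close> inverts \<open>exp\<close>; this explains the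
  bound 1/2 in what follows.\<close>

definition log2pi :: "complex \<Rightarrow> complex" where
  "log2pi a = Ln a / (2 * complex_of_real pi * \<i>)"

lemma exp2pi_log2pi: "a \<noteq> 0 \<Longrightarrow> exp2pi (log2pi a) = a"
  by (simp add: exp2pi_def log2pi_def)

lemma Re_log2pi: "Re (log2pi a) = Im (Ln a) / (2 * pi)"
  by (simp add: log2pi_def Re_divide power2_eq_square)

lemma abs_Re_log2pi:
  assumes "a \<notin> \<real>\<^sub>\<le>\<^sub>0"
  shows "\<bar>Re (log2pi a)\<bar> < 1/2"
proof -
  have "a \<noteq> 0" using assms by auto
  then have "\<bar>Im (Ln a)\<bar> < pi"
    using mpi_less_Im_Ln[of a] Im_Ln_less_pi[OF assms] by (simp add: abs_less_iff)
  then have "\<bar>Im (Ln a)\<bar> / (2 * pi) < 1/2"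
    by (simp add: pos_divide_less_eq)
  then show ?thesis
    unfolding Re_log2pi by (simp only: abs_divide abs_mult abs_numeral abs_of_pos[OF pi_gt_zero])
qed

lemma log2pi_exp2pi:
  assumes "\<bar>Re u\<bar> < 1/2"
  shows "log2pi (exp2pi u) = u" "exp2pi u \<notin> \<real>\<^sub>\<le>\<^sub>0"
proof -
  have "\<bar>Re u\<bar> * (2 * pi) < 1/2 * (2 * pi)"
    using assms by (intro mult_strict_right_mono) auto
  then have "\<bar>2 * pi * Re u\<bar> < pi"
    by (simp add: abs_mult mult_ac)
  moreover have "Im (2 * complex_of_real pi * \<i> * u) = 2 * pi * Re u"
    by simp
  ultimately have im: "- pi < Im (2 * complex_of_real pi * \<i> * u)"
      "Im (2 * complex_of_real pi * \<i> * u) < pi"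
    by linarith+
  then have Ln: "Ln (exp2pi u) = 2 * complex_of_real pi * \<i> * u"
    unfolding exp2pi_def by (intro Ln_exp) auto
  then show "log2pi (exp2pi u) = u"
    by (simp add: log2pi_def)
  \<comment> \<open>A nonzero value on the cut is a negative real, for which the imaginary part of
    \<open>Ln\<close> equals pi; the strict bound \<open>im(2)\<close> excludes it.\<close>
  show "exp2pi u \<notin> \<real>\<^sub>\<le>\<^sub>0"
    using im(2) Im_Ln_eq_pi[of "exp2pi u"] Ln exp2pi_nonzero[of u]
    unfolding complex_nonpos_Reals_iff
    by (metis complex_eq_iff less_eq_real_def less_irrefl zero_complex.sel)
qed

lemma exp2pi_of_int [simp]: "exp2pi (of_int m) = 1"
  by (auto simp: exp2pi_eq_1_iff)

lemma exp2pi_nonpos: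
  assumes "\<bar>Re u\<bar> = 1/2"
  shows "exp2pi u \<in> \<real>\<^sub>\<le>\<^sub>0"
proof -
  have "Re u = 1/2 \<or> Re u = - (1/2)"
    using assms by linarith
  then have "2 * pi * Re u = pi \<or> 2 * pi * Re u = - pi"
    by auto
  then have "cos (2 * pi * Re u) = -1" "sin (2 * pi * Re u) = 0"
    by (elim disjE; simp only: cos_minus sin_minus cos_pi sin_pi; simp)+
  then show ?thesis
    unfolding exp2pi_def complex_nonpos_Reals_iff by (simp add: Re_exp Im_exp)
qed

text \<open>Rounding leaves a distance of at most 1/2, and distance exactly 1/2 would put the value
  on the cut. Thus the integer translates of the open strip exhaust the preimage of the slit
  plane.\<close>

lemma abs_Re_diff_round:
  assumes "exp2pi u \<notin> \<real>\<^sub>\<le>\<^sub>0"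
  shows "\<bar>Re u - of_int (round (Re u))\<bar> < 1/2"
proof -
  have "exp2pi u = exp2pi (u - of_int (round (Re u)))"
    using exp2pi_add[of "u - of_int (round (Re u))" "of_int (round (Re u))"] by simp
  then have "\<bar>Re (u - of_int (round (Re u)))\<bar> \<noteq> 1/2"
    using exp2pi_nonpos assms by metis
  moreover have "\<bar>Re u - of_int (round (Re u))\<bar> \<le> 1/2"
    using of_int_round_abs_le[of "Re u"] by (simp add: abs_minus_commute)
  ultimately show ?thesis by simp
qed

lemma continuous_on_log2pi [continuous_intros]:
  "continuous_on S f \<Longrightarrow> (\<And>z. z \<in> S \<Longrightarrow> f z \<notin> \<real>\<^sub>\<le>\<^sub>0) \<Longrightarrow> continuous_on S (\<lambda>x. log2pi (f x))"
  unfolding log2pi_def by (intro continuous_intros) auto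

lemma continuous_on_exp2pi [continuous_intros]:
  "continuous_on S f \<Longrightarrow> continuous_on S (\<lambda>x. exp2pi (f x))"
  unfolding exp2pi_def by (intro continuous_intros)

text \<open>Only the coordinates in \<open>A\<close> are exponentiated. The others may take the
  value 0 and are kept as they are.\<close>

definition pexp :: "'d set \<Rightarrow> complex ^ 'd \<Rightarrow> complex ^ 'd" where
  "pexp A z = (\<chi> j. if j \<in> A then exp2pi (z $ j) else z $ j)"

definition punctured :: "'d set \<Rightarrow> 'd set \<Rightarrow> (complex ^ 'd) set" where
  "punctured K A = {z \<in> coord_subspace K. \<forall>j\<in>A. z $ j \<noteq> 0}"

lemma pexp_nth [simp]: "pexp A z $ j = (if j \<in> A then exp2pi (z $ j) else z $ j)"
  by (simp add: pexp_def)

text \<open>The condition does not involve the variable; with this rule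
  \<open>continuous_intros\<close> handles vectors whose coordinates are defined by cases on the
  index.\<close>

lemma continuous_on_if_const [continuous_intros]:
  "(P \<Longrightarrow> continuous_on S f) \<Longrightarrow> (\<not> P \<Longrightarrow> continuous_on S g) \<Longrightarrow>
   continuous_on S (\<lambda>x. if P then f x else g x)"
  by (cases P) simp_all

text \<open>The neighbourhood \<open>T\<close> of \<open>x\<close> requires the ratios z_j / x_j to
  avoid the cut, so that z_j has the logarithms log x_j + m_j + log(z_j / x_j) with integers m_j.
  Each choice of integers gives a sheet, a product of strips in the coordinates of \<open>A\<close>,
  with inverse map \<open>q m\<close>.\<close>

lemma covering_space_pexp:
  fixes A K :: "'d::finite set"
  assumes "A \<subseteq> K"
  shows "covering_space (coord_subspace K) (pexp A) (punctured K A)"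
proof
  show cont: "continuous_on (coord_subspace K) (pexp A)"
    unfolding pexp_def by (intro continuous_intros)
  have into: "pexp A ` coord_subspace K \<subseteq> punctured K A"
    using assms by (auto simp: punctured_def coord_subspace_iff)
  have "z \<in> pexp A ` coord_subspace K" if z: "z \<in> punctured K A" for z
  proof (rule image_eqI)
    show "z = pexp A (\<chi> j. if j \<in> A then log2pi (z $ j) else z $ j)"
      using z by (simp add: vec_eq_iff punctured_def exp2pi_log2pi)
    show "(\<chi> j. if j \<in> A then log2pi (z $ j) else z $ j) \<in> coord_subspace K"
      using z assms by (auto simp: punctured_def coord_subspace_iff)
  qed
  with into show "pexp A ` coord_subspace K = punctured K A" by blast
  fix x assume x: "x \<in> punctured K A"
  then have x0: "x $ j \<noteq> 0" if "j \<in> A" for j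
    using that by (simp add: punctured_def)
  define T where "T = {z \<in> punctured K A. \<forall>j\<in>A. z $ j / x $ j \<notin> \<real>\<^sub>\<le>\<^sub>0}"
  define sheet where "sheet m = {e \<in> coord_subspace K.
      \<forall>j\<in>A. \<bar>Re (e $ j - log2pi (x $ j) - of_int (m j))\<bar> < 1/2}" for m :: "'d \<Rightarrow> int"
  define q where "q m z = (\<chi> j. if j \<in> A then log2pi (x $ j) + of_int (m j) + log2pi (z $ j / x $ j)
      else z $ j)" for m :: "'d \<Rightarrow> int" and z
  have openT: "openin (top_of_set (punctured K A)) T"
  proof -
    have "open (\<Inter>j\<in>A. (\<lambda>z. z $ j / x $ j) -` (- \<real>\<^sub>\<le>\<^sub>0))"
      by (intro open_INT ballI open_vimage continuous_intros open_Compl) (auto simp: x0)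
    moreover have "T = punctured K A \<inter> (\<Inter>j\<in>A. (\<lambda>z. z $ j / x $ j) -` (- \<real>\<^sub>\<le>\<^sub>0))"
      by (auto simp: T_def)
    ultimately show ?thesis by (simp add: openin_open_Int)
  qed
  have ratio: "exp2pi (e $ j) / x $ j = exp2pi (e $ j - log2pi (x $ j) - of_int m)"
    if "j \<in> A" for e j m
  proof -
    have "exp2pi (e $ j) = exp2pi ((e $ j - log2pi (x $ j) - of_int m) + (log2pi (x $ j) + of_int m))"
      by simp
    also have "\<dots> = exp2pi (e $ j - log2pi (x $ j) - of_int m) * x $ j"
      unfolding exp2pi_add using x0[OF that] by (simp add: exp2pi_log2pi)
    finally show ?thesis
      using x0[OF that] by simp
  qed
  have sheet_into: "pexp A e \<in> T" "q m (pexp A e) = e" if e: "e \<in> sheet m" for e m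
  proof -
    have strip: "\<bar>Re (e $ j - log2pi (x $ j) - of_int (m j))\<bar> < 1/2" if "j \<in> A" for j
      using e that by (simp add: sheet_def)
    have slit: "exp2pi (e $ j) / x $ j \<notin> \<real>\<^sub>\<le>\<^sub>0"
      and log: "log2pi (exp2pi (e $ j) / x $ j) = e $ j - log2pi (x $ j) - of_int (m j)"
      if "j \<in> A" for j
      unfolding ratio[OF that, of e "m j"] using log2pi_exp2pi[OF strip[OF that]] by blast+
    have "pexp A e \<in> punctured K A"
      using e into by (auto simp: sheet_def)
    then show "pexp A e \<in> T"
      using slit by (simp add: T_def)
    show "q m (pexp A e) = e"
      by (simp add: q_def vec_eq_iff log)
  qed
  have q_into: "q m z \<in> sheet m" "pexp A (q m z) = z" if z: "z \<in> T" for z m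
  proof -
    show "q m z \<in> sheet m"
      using z assms abs_Re_log2pi by (auto simp: q_def sheet_def T_def punctured_def coord_subspace_iff)
    show "pexp A (q m z) = z"
      using z by (simp add: q_def T_def punctured_def vec_eq_iff exp2pi_add exp2pi_log2pi x0)
  qed
  have sheets: "\<Union>(range sheet) = coord_subspace K \<inter> pexp A -` T"
  proof (intro equalityI subsetI)
    fix e assume e: "e \<in> coord_subspace K \<inter> pexp A -` T"
    have "e \<in> sheet (\<lambda>j. round (Re (e $ j - log2pi (x $ j))))"
      unfolding sheet_def
    proof (intro CollectI conjI ballI)
      fix j assume j: "j \<in> A"
      have "exp2pi (e $ j - log2pi (x $ j)) \<notin> \<real>\<^sub>\<le>\<^sub>0"
        using e j ratio[OF j, of e 0] by (auto simp: T_def)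
      from abs_Re_diff_round[OF this]
      show "\<bar>Re (e $ j - log2pi (x $ j) - of_int (round (Re (e $ j - log2pi (x $ j)))))\<bar> < 1/2"
        by simp
    qed (use e in auto)
    then show "e \<in> \<Union>(range sheet)" by blast
  qed (use sheet_into in \<open>auto simp: sheet_def\<close>)
  have open_sheet: "openin (top_of_set (coord_subspace K)) (sheet m)" for m
  proof -
    have "open (\<Inter>j\<in>A. {e :: complex ^ 'd. \<bar>Re (e $ j - log2pi (x $ j) - of_int (m j))\<bar> < 1/2})"
      by (intro open_INT ballI open_Collect_less continuous_intros) auto
    moreover have "sheet m = coord_subspace K \<inter>
        (\<Inter>j\<in>A. {e. \<bar>Re (e $ j - log2pi (x $ j) - of_int (m j))\<bar> < 1/2})"
      by (auto simp: sheet_def)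
    ultimately show ?thesis by (simp add: openin_open_Int)
  qed
  \<comment> \<open>Families \<open>m\<close> that differ only outside \<open>A\<close> define the
    same sheet. Hence disjointness is proved for sheets as sets: two sheets with a common point
    coincide.\<close>
  have disj: "sheet m = sheet n" if e: "e \<in> sheet m" "e \<in> sheet n" for e m n
  proof -
    have "m j = n j" if "j \<in> A" for j
    proof -
      have "\<bar>Re (e $ j - log2pi (x $ j) - of_int (m j))\<bar> < 1/2"
        "\<bar>Re (e $ j - log2pi (x $ j) - of_int (n j))\<bar> < 1/2"
        using e that by (auto simp: sheet_def)
      then have "\<bar>of_int (m j) - of_int (n j) :: real\<bar> < 1"
        unfolding minus_complex.sel abs_less_iff by simp
      then show ?thesis by linarith
    qed
    then show ?thesis by (simp add: sheet_def cong: ball_cong)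
  qed
  have homeo: "homeomorphism (sheet m) T (pexp A) (q m)" for m
  proof (rule homeomorphismI)
    show "continuous_on (sheet m) (pexp A)"
      using cont by (rule continuous_on_subset) (auto simp: sheet_def)
    show "continuous_on T (q m)"
      unfolding q_def by (intro continuous_intros) (auto simp: T_def x0)
    show "pexp A ` sheet m \<subseteq> T" "q m ` T \<subseteq> sheet m"
      using sheet_into(1) q_into(1) by blast+
    show "q m (pexp A e) = e" if "e \<in> sheet m" for e
      by (rule sheet_into(2)[OF that])
    show "pexp A (q m z) = z" if "z \<in> T" for z
      by (rule q_into(2)[OF that])
  qed
  show "\<exists>T. x \<in> T \<and> openin (top_of_set (punctured K A)) T \<and>
          (\<exists>v. \<Union>v = coord_subspace K \<inter> pexp A -` T \<and>
               (\<forall>u\<in>v. openin (top_of_set (coord_subspace K)) u) \<and>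
               pairwise disjnt v \<and> (\<forall>u\<in>v. \<exists>q. homeomorphism u T (pexp A) q))"
  proof (intro exI conjI)
    show "x \<in> T"
      using x x0 by (auto simp: T_def)
    show "\<Union>(range sheet) = coord_subspace K \<inter> pexp A -` T" by (rule sheets)
    show "pairwise disjnt (range sheet)"
    proof (rule pairwiseI)
      fix u v assume "u \<in> range sheet" "v \<in> range sheet" "u \<noteq> v"
      then show "disjnt u v"
        using disj unfolding disjnt_iff by blast
    qed
    show "\<forall>u\<in>range sheet. openin (top_of_set (coord_subspace K)) u"
      using open_sheet by blast
    show "\<forall>u\<in>range sheet. \<exists>q. homeomorphism u T (pexp A) q"
      using homeo by blast
  qed (rule openT)
qed

lemma convex_coord_subspace: "convex (coord_subspace K :: (complex ^ 'd::finite) set)"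
  by (intro subspace_imp_convex) (simp add: subspace_def coord_subspace_iff)

lemma universal_covering_pexp:
  assumes "A \<subseteq> K"
  shows "universal_covering (coord_subspace K) (pexp A) (punctured K A)"
  unfolding universal_covering_def
  by (intro conjI covering_space_pexp[OF assms] convex_imp_simply_connected convex_coord_subspace)

section \<open>The lifted transition maps\<close>

text \<open>In the argument, coordinates in \<open>J - I\<close> are logarithms and those in the
  intersection are actual values; in the result, coordinates in \<open>I - J\<close> are logarithms.
  Accordingly the projection is taken as it stands on \<open>I - J\<close> and enters through its
  exponential on the intersection. The formula also makes sense for \<open>J = UNIV\<close>.\<close>

definition cone_transition ::
  "('d::finite \<Rightarrow> real ^ 'n) \<Rightarrow> 'd set \<Rightarrow> 'd set \<Rightarrow> complex ^ 'd \<Rightarrow> complex ^ 'd" where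
  "cone_transition X I J e =
     (\<chi> i. if i \<in> I - J then cone_proj X I (coord_restrict (J - I) e) $ i
           else if i \<in> I \<inter> J then e $ i * exp2pi (cone_proj X I (coord_restrict (J - I) e) $ i)
           else 0)"

lemma cone_transition_nth:
  "cone_transition X I J e $ i =
     (if i \<in> I - J then cone_proj X I (coord_restrict (J - I) e) $ i
      else if i \<in> I \<inter> J then e $ i * exp2pi (cone_proj X I (coord_restrict (J - I) e) $ i)
      else 0)"
  by (simp add: cone_transition_def)

lemma cone_transition_mem: "cone_transition X I J e \<in> coord_subspace I"
  by (simp add: coord_subspace_iff cone_transition_nth)

lemma continuous_on_cone_transition:
  "continuous_on S (cone_transition X I J)"
  unfolding cone_transition_def cone_proj_nth coord_restrict_nth
  by (intro continuous_intros)

text \<open>Let L be the logarithmic part of \<open>e\<close> and R its projection to C^I. The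
  logarithmic part of the image is R without its coordinates in the intersection. Projecting R back
  to C^J returns L, and the removed part already lies in C^J, so the result is L minus that part. It
  restores \<open>e\<close> on \<open>J - I\<close>, and on the intersection the two factors exp(R)
  and exp(-R) cancel.\<close>

lemma cone_transition_inverse:
  assumes I: "basis_on X I" and J: "basis_on X J" and e: "e \<in> coord_subspace J"
  shows "cone_transition X J I (cone_transition X I J e) = e"
proof -
  define L where "L = coord_restrict (J - I) e"
  define R where "R = cone_proj X I L"
  have R: "R \<in> coord_subspace I"
    unfolding R_def by (rule cone_proj_mem[OF I])
  have L: "L \<in> coord_subspace J"
    by (simp add: L_def coord_subspace_iff)
  have M: "coord_restrict (I \<inter> J) R \<in> coord_subspace J"
    by (simp add: coord_subspace_iff)
  have "coord_restrict (I - J) (cone_transition X I J e) = R - coord_restrict (I \<inter> J) R"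
    using R by (simp add: vec_eq_iff cone_transition_nth R_def L_def coord_subspaceD)
  then have proj: "cone_proj X J (coord_restrict (I - J) (cone_transition X I J e)) = L - coord_restrict (I \<inter> J) R"
    using cone_proj_cone_proj[OF J I, of L]
    by (simp add: cone_proj_diff cone_proj_id[OF J M] cone_proj_id[OF J L] flip: R_def)
  have "cone_transition X J I (cone_transition X I J e) $ j = e $ j" for j
  proof -
    consider "j \<in> J - I" | "j \<in> J \<inter> I" | "j \<notin> J" by blast
    then show ?thesis
    proof cases
      case 1
      then show ?thesis
        by (simp add: cone_transition_nth[of X J I] proj L_def)
    next
      case 2
      then have "cone_transition X I J e $ j = e $ j * exp2pi (R $ j)"
        by (simp add: cone_transition_nth R_def L_def)
      moreover have "(L - coord_restrict (I \<inter> J) R) $ j = - (R $ j)"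
        using 2 by (simp add: L_def)
      ultimately show ?thesis
        using 2 unfolding cone_transition_nth[of X J I] proj
        by (simp add: exp2pi_minus del: vector_minus_component)
    next
      case 3
      then show ?thesis
        using e by (simp add: cone_transition_nth coord_subspaceD)
    qed
  qed
  then show ?thesis by (simp add: vec_eq_iff)
qed

lemma homeomorphism_cone_transition:
  assumes "basis_on X I" "basis_on X J"
  shows "homeomorphism (coord_subspace J) (coord_subspace I)
           (cone_transition X I J) (cone_transition X J I)"
  using assms
  by (intro homeomorphismI continuous_on_cone_transition)
    (simp_all add: image_subset_iff cone_transition_mem cone_transition_inverse)

section \<open>Complex differentiability of scalar functions of several variables\<close>

definition cdiff :: "(complex ^ 'd \<Rightarrow> complex) \<Rightarrow> complex ^ 'd \<Rightarrow> (complex ^ 'd) set \<Rightarrow> bool" where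
  "cdiff f x U \<longleftrightarrow>
     (\<exists>L. (f has_derivative L) (at x within U) \<and> (\<forall>c v. L (c *s v) = c * L v))"

text \<open>Within a set without interior in C^d a derivative need not be unique, so some complex
  linear derivative is chosen for each coordinate and these are assembled into one map.\<close>

lemma holomorphic_vecI:
  fixes f :: "complex ^ 'd::finite \<Rightarrow> complex ^ 'd"
  assumes "\<And>z i. z \<in> U \<Longrightarrow> cdiff (\<lambda>x. f x $ i) z U"
  shows "holomorphic_vec f U"
  unfolding holomorphic_vec_def
proof
  fix z assume "z \<in> U"
  then have "\<forall>i. \<exists>L. ((\<lambda>x. f x $ i) has_derivative L) (at z within U) \<and> (\<forall>c v. L (c *s v) = c * L v)"
    using assms by (simp add: cdiff_def)
  then obtain L where L: "\<And>i. ((\<lambda>x. f x $ i) has_derivative L i) (at z within U)"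
      "\<And>i c v. L i (c *s v) = c * L i v"
    by metis
  have "(f has_derivative (\<lambda>v. \<chi> i. L i v)) (at z within U)"
  \<comment> \<open>The library criterion uses real coordinates. A real basis vector is supported on
    one complex coordinate \<open>k\<close>, so the inner product with it depends only on that
    coordinate.\<close>
  proof (subst has_derivative_componentwise_within, rule ballI)
    fix b :: "complex ^ 'd" assume "b \<in> Basis"
    then obtain k u where b: "b = axis k u"
      by (auto simp: Basis_vec_def)
    have "((\<lambda>x. (f x $ k) \<bullet> u) has_derivative (\<lambda>v. L k v \<bullet> u)) (at z within U)"
      by (rule bounded_linear.has_derivative[OF bounded_linear_inner_left L(1)])
    then show "((\<lambda>x. f x \<bullet> b) has_derivative (\<lambda>v. (\<chi> i. L i v) \<bullet> b)) (at z within U)"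
      by (simp add: b inner_axis)
  qed
  moreover have "\<forall>c v. (\<chi> i. L i (c *s v)) = c *s (\<chi> i. L i v)"
    by (simp add: vec_eq_iff L(2))
  ultimately show "\<exists>L. (f has_derivative L) (at z within U) \<and> (\<forall>c v. L (c *s v) = c *s L v)"
    by (intro exI[of _ "\<lambda>v. \<chi> i. L i v"]) simp
qed

lemma cdiff_const [intro]: "cdiff (\<lambda>x. c) x U"
  unfolding cdiff_def by (rule exI[of _ "\<lambda>v. 0"]) simp

lemma cdiff_component [intro]: "cdiff (\<lambda>x. x $ j) x U"
  unfolding cdiff_def
  by (rule exI[of _ "\<lambda>v. v $ j"])
    (simp add: bounded_linear_imp_has_derivative[OF bounded_linear_vec_nth])

lemma cdiff_add:
  assumes "cdiff f x U" "cdiff g x U"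
  shows "cdiff (\<lambda>x. f x + g x) x U"
proof -
  from assms obtain F G where "(f has_derivative F) (at x within U)" "\<forall>c v. F (c *s v) = c * F v"
    "(g has_derivative G) (at x within U)" "\<forall>c v. G (c *s v) = c * G v"
    by (auto simp: cdiff_def)
  then show ?thesis
    unfolding cdiff_def
    by (intro exI[of _ "\<lambda>v. F v + G v"]) (simp add: has_derivative_add distrib_left)
qed

lemma cdiff_mult:
  assumes "cdiff f x U" "cdiff g x U"
  shows "cdiff (\<lambda>x. f x * g x) x U"
proof -
  from assms obtain F G where "(f has_derivative F) (at x within U)" "\<forall>c v. F (c *s v) = c * F v"
    "(g has_derivative G) (at x within U)" "\<forall>c v. G (c *s v) = c * G v"
    by (auto simp: cdiff_def)
  then have "((\<lambda>x. f x * g x) has_derivative (\<lambda>v. f x * G v + F v * g x)) (at x within U)"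
    and "\<forall>c v. f x * G (c *s v) + F (c *s v) * g x = c * (f x * G v + F v * g x)"
    by (blast intro: has_derivative_mult, simp add: distrib_left mult_ac)
  then show ?thesis
    unfolding cdiff_def by (intro exI[of _ "\<lambda>v. f x * G v + F v * g x"]) blast
qed

lemma cdiff_sum: "(\<And>j. j \<in> A \<Longrightarrow> cdiff (f j) x U) \<Longrightarrow> cdiff (\<lambda>x. \<Sum>j\<in>A. f j x) x U"
  by (induction A rule: infinite_finite_induct) (auto intro: cdiff_add)

lemma cdiff_compose:
  assumes "(g has_field_derivative g') (at (f x))" "cdiff f x U"
  shows "cdiff (\<lambda>x. g (f x)) x U"
proof -
  from assms(2) obtain F where F: "(f has_derivative F) (at x within U)" "\<forall>c v. F (c *s v) = c * F v"
    by (auto simp: cdiff_def)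
  have "((\<lambda>x. g (f x)) has_derivative (\<lambda>v. g' * F v)) (at x within U)"
    using has_derivative_compose[OF F(1)] assms(1) by (simp add: has_field_derivative_def)
  then show ?thesis
    unfolding cdiff_def using F(2) by (intro exI[of _ "\<lambda>v. g' * F v"]) simp
qed

lemma cdiff_transform_within:
  assumes "cdiff f x U" "0 < d" "x \<in> U" "\<And>y. y \<in> U \<Longrightarrow> dist y x < d \<Longrightarrow> f y = g y"
  shows "cdiff g x U"
proof -
  from assms(1) obtain L where L: "(f has_derivative L) (at x within U)" "\<forall>c v. L (c *s v) = c * L v"
    by (auto simp: cdiff_def)
  have "(g has_derivative L) (at x within U)"
    by (rule has_derivative_transform_within[OF L(1) assms(2-4)])
  with L(2) show ?thesis
    by (auto simp: cdiff_def)
qed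

lemma cdiff_exp2pi:
  assumes "cdiff f x U"
  shows "cdiff (\<lambda>x. exp2pi (f x)) x U"
proof (rule cdiff_compose[where f=f, OF _ assms])
  show "(exp2pi has_field_derivative (exp (2 * complex_of_real pi * \<i> * f x) *
          (2 * complex_of_real pi * \<i>))) (at (f x))"
    unfolding exp2pi_def[abs_def] by (auto intro!: derivative_eq_intros)
qed

text \<open>The covering notion quantifies over arbitrary continuous local sections, whose
  coordinates are continuous logarithms. Near \<open>z\<close> such a logarithm stays within 1/2 of
  \<open>c z\<close>, the half-width of the principal strip, and so equals \<open>c z\<close> plus
  the principal logarithm of x_j / z_j.\<close>

lemma cdiff_continuous_log:
  assumes cont: "continuous_on U c" and log: "\<And>x. x \<in> U \<Longrightarrow> exp2pi (c x) = x $ j" and z: "z \<in> U"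
  shows "cdiff c z U"
proof -
  have nz: "z $ j \<noteq> 0"
    using log[OF z] exp2pi_nonzero by metis
  obtain d where d: "d > 0" "\<And>x. x \<in> U \<Longrightarrow> dist x z < d \<Longrightarrow> dist (c x) (c z) < 1/2"
    using cont z unfolding continuous_on_iff by (meson half_gt_zero zero_less_one)
  have eq: "c z + log2pi (x $ j * inverse (z $ j)) = c x" if x: "x \<in> U" "dist x z < d" for x
  proof -
    have "\<bar>Re (c x - c z)\<bar> < 1/2"
      using d(2)[OF x] abs_Re_le_cmod[of "c x - c z"] by (simp add: dist_norm)
    moreover have "exp2pi (c x - c z) = x $ j * inverse (z $ j)"
      using exp2pi_add[of "c x" "- c z"] by (simp add: exp2pi_minus log x z)
    ultimately show ?thesis
      using log2pi_exp2pi(1)[of "c x - c z"] by simp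
  qed
  have "(log2pi has_field_derivative inverse (2 * complex_of_real pi * \<i>)) (at (z $ j * inverse (z $ j)))"
    unfolding log2pi_def[abs_def] using nz
    by (auto intro!: derivative_eq_intros simp: field_simps)
  then have "cdiff (\<lambda>x. log2pi (x $ j * inverse (z $ j))) z U"
    by (rule cdiff_compose[where f="\<lambda>x. x $ j * inverse (z $ j)"])
      (rule cdiff_mult[OF cdiff_component cdiff_const])
  then have "cdiff (\<lambda>x. c z + log2pi (x $ j * inverse (z $ j))) z U"
    by (rule cdiff_add[OF cdiff_const])
  then show ?thesis
    by (rule cdiff_transform_within[OF _ d(1) z eq])
qed

text \<open>Along a local section the coordinates in \<open>J - I\<close> are continuous logarithms,
  hence holomorphic, while those in the intersection are the coordinates of \<open>x\<close> itself.
  The composite is built from them by linear combinations, exponentials and products.\<close>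

lemma covering_holomorphic_cone_transition:
  "covering_holomorphic (coord_subspace J) (pexp (J - I)) (punctured J (J - I))
     (coord_subspace I) (pexp (I - J)) (cone_transition X I J)"
  unfolding covering_holomorphic_def
proof (intro conjI allI impI continuous_on_cone_transition)
  show "cone_transition X I J ` coord_subspace J \<subseteq> coord_subspace I"
    using cone_transition_mem by blast
  fix U s
  assume s: "openin (top_of_set (punctured J (J - I))) U \<and> continuous_on U s \<and>
    s ` U \<subseteq> coord_subspace J \<and> (\<forall>x\<in>U. pexp (J - I) (s x) = x)"
  have pexp_s: "pexp (J - I) (s x) $ j = x $ j" if "x \<in> U" for x j
    using s that by simp
  show "holomorphic_vec (pexp (I - J) \<circ> cone_transition X I J \<circ> s) U"
  proof (rule holomorphic_vecI)
    fix z i assume z: "z \<in> U"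
    have "cdiff (\<lambda>x. s x $ j) z U" if "j \<in> J - I" for j
    proof (rule cdiff_continuous_log)
      show "continuous_on U (\<lambda>x. s x $ j)"
        using s by (intro continuous_intros) auto
      show "exp2pi (s x $ j) = x $ j" if "x \<in> U" for x
        using pexp_s[OF that, of j] \<open>j \<in> J - I\<close> by simp
    qed (rule z)
    then have "cdiff (\<lambda>x. if j \<in> J - I then s x $ j else 0) z U" for j
      by (cases "j \<in> J - I") auto
    then have proj: "cdiff (\<lambda>x. exp2pi (cone_proj X I (coord_restrict (J - I) (s x)) $ i)) z U"
      unfolding cone_proj_nth coord_restrict_nth
      by (intro cdiff_exp2pi cdiff_sum cdiff_mult cdiff_const)
    have nth: "(pexp (I - J) \<circ> cone_transition X I J \<circ> s) x $ i =
        (if i \<in> I - J then exp2pi (cone_proj X I (coord_restrict (J - I) (s x)) $ i)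
         else if i \<in> I \<inter> J then x $ i * exp2pi (cone_proj X I (coord_restrict (J - I) (s x)) $ i) else 0)"
      if "x \<in> U" for x
      using pexp_s[OF that, of i] by (auto simp: cone_transition_nth)
    have "cdiff (\<lambda>x. if i \<in> I - J then exp2pi (cone_proj X I (coord_restrict (J - I) (s x)) $ i)
         else if i \<in> I \<inter> J then x $ i * exp2pi (cone_proj X I (coord_restrict (J - I) (s x)) $ i) else 0) z U"
      using proj by (cases "i \<in> I"; cases "i \<in> J") (auto intro: cdiff_mult)
    then show "cdiff (\<lambda>x. (pexp (I - J) \<circ> cone_transition X I J \<circ> s) x $ i) z U"
      by (rule cdiff_transform_within[OF _ zero_less_one z nth[symmetric]])
  qed
qed

lemma covering_biholomorphism_cone_transition:
  assumes "basis_on X I" "basis_on X J"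
  shows "covering_biholomorphism (coord_subspace J) (pexp (J - I)) (punctured J (J - I))
     (coord_subspace I) (pexp (I - J)) (punctured I (I - J)) (cone_transition X I J)"
  unfolding covering_biholomorphism_def
  using homeomorphism_cone_transition[OF assms] covering_holomorphic_cone_transition by blast

section \<open>The charts\<close>

context quasilattice_vectors
begin

definition eta_on :: "'d set \<Rightarrow> (complex ^ 'd) set \<Rightarrow> (complex ^ 'd) set" where
  "eta_on I c = (\<Union>z\<in>c. orbit (N_C Q X) (ext_one I z))"

definition V_on :: "'d set \<Rightarrow> (complex ^ 'd) set set" where
  "V_on I = orbit_set (punctured UNIV (- I)) (N_C Q X)"

definition chart_on :: "'d set \<Rightarrow> ('d, (complex ^ 'd) set) qchart" where
  "chart_on I = (coord_subspace I, Gamma_on I, V_on I, eta_on I)"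

lemma orbit_N_eqI: "g \<in> N_C Q X \<Longrightarrow> z = g * w \<Longrightarrow> orbit (N_C Q X) z = orbit (N_C Q X) w"
  using orbit_eqI[OF mult_subgroup_N] by blast

text \<open>With L the logarithmic part of \<open>e\<close> and R its projection, exp(R - L) lies in
  N. It turns the coordinates in \<open>J - I\<close> into 1 and multiplies those in
  \<open>I\<close> by exp(R). The set \<open>J\<close> is arbitrary here because
  \<open>J = UNIV\<close> is the case used to normalize points of U_I.\<close>

lemma orbit_cone_transition:
  assumes I: "basis_on X I"
  shows "orbit (N_C Q X) (ext_one I (pexp (I - J) (cone_transition X I J e))) =
         orbit (N_C Q X) (ext_one J (pexp (J - I) e))"
proof (rule orbit_N_eqI)
  define L where "L = coord_restrict (J - I) e"
  show "torus_exp (cone_proj X I L - L) \<in> N_C Q X"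
    by (rule torus_exp_kernel_mem) (simp add: pi_complex_diff pi_complex_cone_proj[OF I])
  have outside: "cone_proj X I L $ j = 0" if "j \<notin> I" for j
    using coord_subspaceD[OF cone_proj_mem[OF I] that] .
  show "ext_one I (pexp (I - J) (cone_transition X I J e)) =
        torus_exp (cone_proj X I L - L) * ext_one J (pexp (J - I) e)"
    unfolding vec_eq_iff
  proof
    fix j
    consider "j \<in> I - J" | "j \<in> I \<inter> J" | "j \<in> J - I" | "j \<notin> I" "j \<notin> J" by blast
    then show "ext_one I (pexp (I - J) (cone_transition X I J e)) $ j =
        (torus_exp (cone_proj X I L - L) * ext_one J (pexp (J - I) e)) $ j"
    proof cases
      case 1
      then have "L $ j = 0" by (simp add: L_def)
      with 1 show ?thesis
        by (simp add: cone_transition_nth flip: L_def)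
    next
      case 2
      then have "L $ j = 0" by (simp add: L_def)
      with 2 show ?thesis
        by (simp add: cone_transition_nth flip: L_def)
    next
      case 3
      then have "L $ j = e $ j" by (simp add: L_def)
      with 3 show ?thesis
        by (simp add: outside exp2pi_minus)
    next
      case 4
      then have "L $ j = 0" by (simp add: L_def)
      with 4 show ?thesis
        by (simp add: outside)
    qed
  qed
qed

text \<open>All representatives yield the same N-orbit since Gamma lies in N; non-emptiness of Gamma
  ensures that the union over them is this orbit and not the empty set.\<close>

lemma eta_on_orbit:
  assumes I: "basis_on X I"
  shows "eta_on I (orbit (Gamma_on I) z) = orbit (N_C Q X) (ext_one I z)"
proof -
  have "orbit (N_C Q X) (ext_one I (g * z)) = orbit (N_C Q X) (ext_one I z)" if "g \<in> Gamma_on I" for g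
    using that Gamma_on_eq[OF I] by (intro orbit_N_eqI[of g] ext_one_Gamma[OF I]) auto
  moreover have "Gamma_on I \<noteq> {}"
    using mult_subgroup_Gamma[OF I] by (auto simp: mult_subgroup_def)
  ultimately show ?thesis
    by (auto simp: eta_on_def orbit_def[of "Gamma_on I"])
qed

lemma punctured_invariant: "g \<in> N_C Q X \<Longrightarrow> g * z \<in> punctured UNIV A \<longleftrightarrow> z \<in> punctured UNIV A"
  by (simp add: punctured_def coord_subspace_iff N_nonzero)

lemma orbit_mem_V_on_iff: "orbit (N_C Q X) z \<in> V_on I \<longleftrightarrow> z \<in> punctured UNIV (- I)"
  unfolding V_on_def orbit_set_def image_iff orbit_eq_iff[OF mult_subgroup_N]
  using punctured_invariant by (metis orbit_eqI orbit_eq_iff mult_subgroup_N)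

text \<open>This is the lifted transition for \<open>J = UNIV\<close>. As \<open>I - UNIV\<close> is
  empty, its result consists of actual coordinates and needs no further exponential.\<close>

lemma V_on_class_representative:
  assumes I: "basis_on X I" and z: "z \<in> punctured UNIV (- I)"
  obtains e where "z = pexp (- I) e" "cone_transition X I UNIV e \<in> coord_subspace I"
    "orbit (N_C Q X) (ext_one I (cone_transition X I UNIV e)) = orbit (N_C Q X) z"
proof -
  have "z \<in> pexp (- I) ` coord_subspace UNIV"
    using covering_space_imp_surjective[OF covering_space_pexp[of "- I" UNIV]] z by simp
  then obtain e where e: "z = pexp (- I) e" by blast
  have "ext_one UNIV (pexp (UNIV - I) e) = z" "pexp (I - UNIV) w = w" for w
    by (simp_all add: vec_eq_iff e)
  then show ?thesis
    using that[OF e cone_transition_mem] orbit_cone_transition[OF I, of UNIV e] by simp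
qed

lemma ext_one_mem_punctured: "ext_one I z \<in> punctured UNIV (- I)"
  by (simp add: punctured_def coord_subspace_iff)

lemma bij_betw_eta_on:
  assumes I: "basis_on X I"
  shows "bij_betw (eta_on I) (orbit_set (coord_subspace I) (Gamma_on I)) (V_on I)"
  unfolding bij_betw_def
proof
  show "inj_on (eta_on I) (orbit_set (coord_subspace I) (Gamma_on I))"
    unfolding orbit_set_def
    by (rule inj_onI) (auto simp: eta_on_orbit[OF I] orbit_ext_one_eq_iff[OF I])
  show "eta_on I ` orbit_set (coord_subspace I) (Gamma_on I) = V_on I"
  proof (intro equalityI subsetI)
    fix c assume "c \<in> eta_on I ` orbit_set (coord_subspace I) (Gamma_on I)"
    then show "c \<in> V_on I"
      using ext_one_mem_punctured
      by (auto simp: orbit_set_def eta_on_orbit[OF I] orbit_mem_V_on_iff)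
  next
    fix c assume "c \<in> V_on I"
    then obtain z where z: "z \<in> punctured UNIV (- I)" "c = orbit (N_C Q X) z"
      by (auto simp: V_on_def orbit_set_def)
    obtain e where e: "z = pexp (- I) e" "cone_transition X I UNIV e \<in> coord_subspace I"
      "orbit (N_C Q X) (ext_one I (cone_transition X I UNIV e)) = orbit (N_C Q X) z"
      using V_on_class_representative[OF I z(1)] .
    then have "c = eta_on I (orbit (Gamma_on I) (cone_transition X I UNIV e))"
      using z(2) eta_on_orbit[OF I] by simp
    then show "c \<in> eta_on I ` orbit_set (coord_subspace I) (Gamma_on I)"
      using e(2) by (auto simp: orbit_set_def)
  qed
qed

section \<open>Open sets in the quotients and the homeomorphism property of the charts\<close>

lemma open_punctured_UNIV: "open (punctured UNIV A :: (complex ^ 'd) set)"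
proof -
  have "open (\<Inter>j\<in>A. (\<lambda>z :: complex ^ 'd. z $ j) -` (- {0}))"
    by (intro open_INT ballI open_vimage continuous_intros open_Compl) auto
  moreover have "punctured UNIV A = (\<Inter>j\<in>A. (\<lambda>z :: complex ^ 'd. z $ j) -` (- {0}))"
    by (auto simp: punctured_def coord_subspace_iff)
  ultimately show ?thesis by simp
qed

text \<open>From right to left this is continuity of \<open>ext_one\<close>. Conversely, pulling
  back along the lifted normalization gives an open set of logarithms, saturated for the covering
  \<open>pexp (- I)\<close>; the image under this open map is the set in question.\<close>

lemma open_orbit_preimage_iff:
  assumes I: "basis_on X I"
  shows "openin (top_of_set (coord_subspace I)) {z \<in> coord_subspace I. orbit (N_C Q X) (ext_one I z) \<in> U}
    \<longleftrightarrow> open {z \<in> punctured UNIV (- I). orbit (N_C Q X) z \<in> U}" (is "?L \<longleftrightarrow> open ?B")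
proof
  assume open_B: "open ?B"
  have "continuous_on UNIV (ext_one I)"
    unfolding ext_one_def by (intro continuous_intros)
  from open_vimage[OF open_B this]
  have "openin (top_of_set (coord_subspace I)) (coord_subspace I \<inter> ext_one I -` ?B)"
    by (simp add: openin_open_Int)
  moreover have "coord_subspace I \<inter> ext_one I -` ?B =
      {z \<in> coord_subspace I. orbit (N_C Q X) (ext_one I z) \<in> U}"
    using ext_one_mem_punctured by blast
  ultimately show ?L by simp
next
  assume ?L
  then obtain S where S: "open S"
    "{z \<in> coord_subspace I. orbit (N_C Q X) (ext_one I z) \<in> U} = coord_subspace I \<inter> S"
    by (auto simp: openin_open)
  have cov: "covering_space UNIV (pexp (- I)) (punctured UNIV (- I))"
    using covering_space_pexp[of "- I" UNIV] by (simp add: coord_subspace_def)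
  let ?E = "cone_transition X I UNIV -` S"
  have E: "e \<in> ?E \<longleftrightarrow> orbit (N_C Q X) (pexp (- I) e) \<in> U" for e
  proof -
    have "ext_one UNIV (pexp (UNIV - I) e) = pexp (- I) e" "pexp (I - UNIV) w = w" for w
      by (simp_all add: vec_eq_iff)
    then have "orbit (N_C Q X) (ext_one I (cone_transition X I UNIV e)) =
        orbit (N_C Q X) (pexp (- I) e)"
      using orbit_cone_transition[OF I, of UNIV e] by simp
    moreover have "cone_transition X I UNIV e \<in> coord_subspace I"
      by (rule cone_transition_mem)
    ultimately show ?thesis
      using set_eq_iff[THEN iffD1, OF S(2), rule_format, of "cone_transition X I UNIV e"] by simp
  qed
  have "open ?E"
    by (rule open_vimage[OF S(1) continuous_on_cone_transition])
  then have "openin (top_of_set (punctured UNIV (- I))) (pexp (- I) ` ?E)"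
    by (intro covering_space_open_map[OF cov]) simp
  moreover have "pexp (- I) ` ?E = ?B"
  proof -
    have "pexp (- I) ` UNIV = punctured UNIV (- I)"
      by (rule covering_space_imp_surjective[OF cov])
    then have "?B = {z \<in> range (pexp (- I)). orbit (N_C Q X) z \<in> U}" by simp
    also have "\<dots> = pexp (- I) ` {e. orbit (N_C Q X) (pexp (- I) e) \<in> U}" by blast
    also have "{e. orbit (N_C Q X) (pexp (- I) e) \<in> U} = ?E"
      by (simp add: set_eq_iff E del: vimage_eq)
    finally show ?thesis by simp
  qed
  ultimately show "open ?B"
    using openin_open_trans[OF _ open_punctured_UNIV] by simp
qed

lemma openin_orbit_space:
  "openin (orbit_space M G) U \<longleftrightarrow>
     U \<subseteq> orbit G ` M \<and> openin (top_of_set M) {z \<in> M. orbit G z \<in> U}"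
  by (simp add: orbit_space_def openin_quotient_topology)

text \<open>U_I is a union of N-orbits, so the preimage in \<open>M\<close> of a subset of
  \<open>V_on I\<close> already lies in U_I.\<close>

lemma openin_V_on_iff:
  assumes "open M" "punctured UNIV (- I) \<subseteq> M" "U \<subseteq> V_on I"
  shows "openin (orbit_space M (N_C Q X)) U \<longleftrightarrow> open {z \<in> punctured UNIV (- I). orbit (N_C Q X) z \<in> U}"
proof -
  have "{z \<in> M. orbit (N_C Q X) z \<in> U} = {z \<in> punctured UNIV (- I). orbit (N_C Q X) z \<in> U}"
    using assms(2,3) orbit_mem_V_on_iff by blast
  moreover have "U \<subseteq> orbit (N_C Q X) ` M"
    using assms(2,3) unfolding V_on_def orbit_set_def by blast
  ultimately show ?thesis
    unfolding openin_orbit_space using assms(1) by (auto simp: openin_open_eq)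
qed

lemma openin_V_on:
  assumes "open M" "punctured UNIV (- I) \<subseteq> M"
  shows "openin (orbit_space M (N_C Q X)) (V_on I)"
  unfolding openin_V_on_iff[OF assms order.refl] orbit_mem_V_on_iff
  using open_punctured_UNIV by simp

text \<open>A homeomorphic map is an injective quotient map, so a single equivalence of openness
  replaces separate continuity proofs for the chart and its inverse.\<close>

lemma homeomorphic_map_eta_on:
  assumes I: "basis_on X I" and M: "open M" "punctured UNIV (- I) \<subseteq> M"
  shows "homeomorphic_map (orbit_space (coord_subspace I) (Gamma_on I))
           (subtopology (orbit_space M (N_C Q X)) (V_on I)) (eta_on I)"
proof -
  have top1: "topspace (orbit_space (coord_subspace I) (Gamma_on I)) =
      orbit_set (coord_subspace I) (Gamma_on I)"
    by (simp add: orbit_space_def topspace_quotient_topology orbit_set_def)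
  have top2: "topspace (subtopology (orbit_space M (N_C Q X)) (V_on I)) = V_on I"
    using openin_subset[OF openin_V_on[OF M]] by auto
  have bij: "inj_on (eta_on I) (orbit_set (coord_subspace I) (Gamma_on I))"
    "eta_on I ` orbit_set (coord_subspace I) (Gamma_on I) = V_on I"
    using bij_betw_eta_on[OF I] by (auto simp: bij_betw_def)
  have "openin (orbit_space (coord_subspace I) (Gamma_on I))
          {c \<in> orbit_set (coord_subspace I) (Gamma_on I). eta_on I c \<in> U} \<longleftrightarrow>
        openin (subtopology (orbit_space M (N_C Q X)) (V_on I)) U" if U: "U \<subseteq> V_on I" for U
  proof -
    have "{z \<in> coord_subspace I. orbit (Gamma_on I) z \<in>
            {c \<in> orbit_set (coord_subspace I) (Gamma_on I). eta_on I c \<in> U}} =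
          {z \<in> coord_subspace I. orbit (N_C Q X) (ext_one I z) \<in> U}"
      by (auto simp: eta_on_orbit[OF I] orbit_set_def)
    then have "openin (orbit_space (coord_subspace I) (Gamma_on I))
          {c \<in> orbit_set (coord_subspace I) (Gamma_on I). eta_on I c \<in> U} \<longleftrightarrow>
        open {z \<in> punctured UNIV (- I). orbit (N_C Q X) z \<in> U}"
      unfolding openin_orbit_space open_orbit_preimage_iff[OF I, symmetric]
      by (auto simp: orbit_set_def)
    also have "\<dots> \<longleftrightarrow> openin (subtopology (orbit_space M (N_C Q X)) (V_on I)) U"
      unfolding openin_open_subtopology[OF openin_V_on[OF M]] openin_V_on_iff[OF M U] using U by simp
    finally show ?thesis .
  qed
  then show ?thesis
    unfolding homeomorphic_map_def quotient_map_def top1 top2 using bij by blast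
qed

section \<open>Overlaps and transition maps\<close>

lemma chart_preimage_eq:
  assumes J: "basis_on X J"
  shows "chart_preimage (chart_on J) (V_on I \<inter> V_on J) = punctured J (J - I)"
proof -
  have "ext_one J z \<in> punctured UNIV (- I) \<longleftrightarrow> (\<forall>j\<in>J - I. z $ j \<noteq> 0)" for z
    by (auto simp: punctured_def coord_subspace_iff)
  then show ?thesis
    using ext_one_mem_punctured
    by (auto simp: chart_preimage_def chart_on_def eta_on_orbit[OF J] orbit_mem_V_on_iff
        punctured_def[of J])
qed

lemma transition_eqI:
  assumes I: "basis_on X I" and J: "basis_on X J" and w: "w \<in> coord_subspace I"
    and "orbit (N_C Q X) (ext_one I w) = orbit (N_C Q X) (ext_one J z)"
  shows "transition (chart_on I) (chart_on J) (orbit (Gamma_on J) z) = orbit (Gamma_on I) w"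
proof -
  have "eta_on J (orbit (Gamma_on J) z) = eta_on I (orbit (Gamma_on I) w)"
    using assms by (simp add: eta_on_orbit)
  moreover have "orbit (Gamma_on I) w \<in> orbit_set (coord_subspace I) (Gamma_on I)"
    using w by (simp add: orbit_set_def)
  ultimately show ?thesis
    using bij_betw_imp_inj_on[OF bij_betw_eta_on[OF I]]
    by (simp add: transition_def chart_on_def chart_inverse_def)
qed

lemma transition_pexp:
  assumes I: "basis_on X I" and J: "basis_on X J"
  shows "transition (chart_on I) (chart_on J) (orbit (Gamma_on J) (pexp (J - I) e)) =
         orbit (Gamma_on I) (pexp (I - J) (cone_transition X I J e))"
proof (rule transition_eqI[OF I J _ orbit_cone_transition[OF I]])
  show "pexp (I - J) (cone_transition X I J e) \<in> coord_subspace I"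
    using cone_transition_mem[of X I J e] by (simp add: coord_subspace_iff)
qed

lemma compatible_charts:
  assumes I: "basis_on X I" and J: "basis_on X J"
  shows "compatible (chart_on I) (chart_on J)"
proof -
  have *: "chart_preimage (chart_on I) (V_on I \<inter> V_on J) = punctured I (I - J)"
    using chart_preimage_eq[OF I, of J] by (simp add: Int_commute)
  have "\<exists>(E :: (complex ^ 'd) set) p (E' :: (complex ^ 'd) set) p' F.
      universal_covering E p (punctured J (J - I)) \<and> universal_covering E' p' (punctured I (I - J)) \<and>
      covering_biholomorphism E p (punctured J (J - I)) E' p' (punctured I (I - J)) F \<and>
      (\<forall>e\<in>E. orbit (Gamma_on I) (p' (F e)) =
         transition (chart_on I) (chart_on J) (orbit (Gamma_on J) (p e)))"
  proof (intro exI conjI)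
    show "universal_covering (coord_subspace J) (pexp (J - I)) (punctured J (J - I))"
      "universal_covering (coord_subspace I) (pexp (I - J)) (punctured I (I - J))"
      by (rule universal_covering_pexp; blast)+
    show "covering_biholomorphism (coord_subspace J) (pexp (J - I)) (punctured J (J - I))
      (coord_subspace I) (pexp (I - J)) (punctured I (I - J)) (cone_transition X I J)"
      by (rule covering_biholomorphism_cone_transition[OF I J])
  qed (simp add: transition_pexp[OF I J])
  then show ?thesis
    using * chart_preimage_eq[OF J, of I]
    unfolding compatible_def by (simp add: chart_on_def Let_def)
qed

lemma transition_laurent:
  assumes I: "basis_on X I" and J: "basis_on X J" and z: "z \<in> punctured J (J - I)"
    and log: "\<forall>j\<in>J - I. exp2pi (\<zeta> j) = z $ j"
  shows "transition (chart_on I) (chart_on J) (orbit (Gamma_on J) z) =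
    orbit (Gamma_on I)
      (\<chi> i. if i \<in> I - J then laurent_monomial (J - I) (coord_rep X I) \<zeta> i
            else if i \<in> I \<inter> J then z $ i * laurent_monomial (J - I) (coord_rep X I) \<zeta> i
            else 0)"
proof -
  \<comment> \<open>The chosen logarithms single out a point of the universal covering above
    \<open>z\<close>, at which the lifted transition is evaluated.\<close>
  define e where "e = (\<chi> j. if j \<in> J - I then \<zeta> j else z $ j)"
  have e: "pexp (J - I) e = z"
    using log by (simp add: vec_eq_iff e_def)
  have "cone_proj X I (coord_restrict (J - I) e) $ i =
      (\<Sum>j\<in>J - I. complex_of_real (coord_rep X I j $ i) * \<zeta> j)" for i
  proof -
    have "cone_proj X I (coord_restrict (J - I) e) $ i =
        (\<Sum>j\<in>UNIV. if j \<in> J - I then complex_of_real (coord_rep X I j $ i) * \<zeta> j else 0)"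
      unfolding cone_proj_nth by (intro sum.cong) (auto simp: e_def)
    then show ?thesis
      by (simp add: sum.If_cases Int_commute flip: set_diff_eq)
  qed
  then have "exp2pi (cone_proj X I (coord_restrict (J - I) e) $ i) =
      laurent_monomial (J - I) (coord_rep X I) \<zeta> i" for i
    by (simp add: laurent_monomial_def exp2pi_sum)
  then have "pexp (I - J) (cone_transition X I J e) =
      (\<chi> i. if i \<in> I - J then laurent_monomial (J - I) (coord_rep X I) \<zeta> i
            else if i \<in> I \<inter> J then z $ i * laurent_monomial (J - I) (coord_rep X I) \<zeta> i
            else 0)"
    by (auto simp: vec_eq_iff cone_transition_nth e_def)
  then show ?thesis
    using transition_pexp[OF I J, of e] e by simp
qed

end

section \<open>Fixed points\<close>

lemma pi_complex_surj:
  assumes I: "basis_on X I"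
  obtains W where "W \<in> coord_subspace I" "pi_complex X W = w"
proof -
  have surj: "\<exists>x\<in>coord_subspace I. pi_real X x = y" for y
    using I unfolding basis_on_def bij_betw_def by (metis UNIV_I imageE)
  obtain x y where x: "x \<in> coord_subspace I" "pi_real X x = (\<chi> i. Re (w $ i))"
    and y: "y \<in> coord_subspace I" "pi_real X y = (\<chi> i. Im (w $ i))"
    using surj by metis
  define W where "W = (\<chi> j. Complex (x $ j) (y $ j))"
  show thesis
  proof
    show "W \<in> coord_subspace I"
      using x(1) y(1) by (simp add: W_def coord_subspace_iff Complex_eq_0)
    have "(\<chi> i. Re (pi_complex X W $ i)) = (\<chi> i. Re (w $ i))"
      using pi_real_Re[of X W] x(2) by (simp add: W_def)
    moreover have "(\<chi> i. Im (pi_complex X W $ i)) = (\<chi> i. Im (w $ i))"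
      using pi_real_Im[of X W] y(2) by (simp add: W_def)
    ultimately show "pi_complex X W = w"
      by (simp add: vec_eq_iff complex_eq_iff)
  qed
qed

context quasilattice_vectors
begin

text \<open>Coordinates in \<open>I\<close> are irrelevant at this point. Subtracting from Z its
  projection to C^I thus does not change the action and moves exp(Z) into N. For the other
  inclusion, the coset has a representative coming from C^I, which acts trivially on the
  class.\<close>

lemma quasitorus_act_fixed_point:
  assumes I: "basis_on X I" and a: "a \<in> quasitorus Q"
  shows "quasitorus_act X a (orbit (N_C Q X) (ext_one I 0)) = orbit (N_C Q X) (ext_one I 0)"
proof (intro equalityI subsetI)
  let ?p = "ext_one I 0"
  have NN: "g * h \<in> N_C Q X" if "g \<in> N_C Q X" "h \<in> N_C Q X" for g h
    using that mult_subgroup_N by (simp add: mult_subgroup_def)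
  fix y assume "y \<in> quasitorus_act X a (orbit (N_C Q X) ?p)"
  then obtain Z g where g: "g \<in> N_C Q X" and y: "y = torus_exp Z * (g * ?p)"
    by (auto simp: quasitorus_act_def mem_orbit_iff)
  have "torus_exp Z * ?p = torus_exp (Z - cone_proj X I Z) * ?p"
    using coord_subspaceD[OF cone_proj_mem[OF I, of Z]] by (simp add: vec_eq_iff)
  then have "y = (g * torus_exp (Z - cone_proj X I Z)) * ?p"
    unfolding y by (metis mult.assoc mult.commute)
  moreover have "torus_exp (Z - cone_proj X I Z) \<in> N_C Q X"
    by (rule torus_exp_kernel_mem) (simp add: pi_complex_diff pi_complex_cone_proj[OF I])
  ultimately show "y \<in> orbit (N_C Q X) ?p"
    using NN g by (auto simp: mem_orbit_iff)
next
  let ?p = "ext_one I 0"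
  fix y assume y: "y \<in> orbit (N_C Q X) ?p"
  obtain w where w: "a = (\<lambda>q. w + complexify q) ` Q"
    using a by (auto simp: quasitorus_def)
  obtain W where W: "W \<in> coord_subspace I" "pi_complex X W = w"
    using pi_complex_surj[OF I] .
  obtain g where g: "y = g * ?p"
    using y by (auto simp: mem_orbit_iff)
  have "torus_exp W * y = y"
    using coord_subspaceD[OF W(1)] by (simp add: g vec_eq_iff)
  moreover have "pi_complex X W \<in> a"
    unfolding w W(2) using zero_mem by (intro image_eqI[of _ _ 0]) (simp_all add: vec_eq_iff)
  ultimately show "y \<in> quasitorus_act X a (orbit (N_C Q X) ?p)"
    using y unfolding quasitorus_act_def by (metis (mono_tags, lifting) mem_Collect_eq)
qed

text \<open>
  Moving a single coordinate by \<open>exp2pi \<i>\<close>, which is not of modulus \<open>1\<close>, cannot be undone by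
  \<open>\<Gamma>\<close>, a subgroup of the compact torus.
\<close>

lemma fixed_point_coordinates_zero:
  assumes I: "basis_on X I" and w: "w \<in> coord_subspace I"
    and fixed: "\<And>a. a \<in> quasitorus Q \<Longrightarrow>
      quasitorus_act X a (orbit (N_C Q X) (ext_one I w)) = orbit (N_C Q X) (ext_one I w)"
  shows "w = 0"
proof (rule ccontr)
  assume "w \<noteq> 0"
  then obtain i where wi: "w $ i \<noteq> 0"
    by (auto simp: vec_eq_iff)
  then have i: "i \<in> I"
    using w coord_subspaceD by blast
  let ?z = "ext_one I w" and ?T = "torus_exp (axis i \<i>)"
  let ?a = "(\<lambda>q. pi_complex X (axis i \<i>) + complexify q) ` Q"
  have "pi_complex X (axis i \<i>) \<in> ?a"
    using zero_mem by (intro image_eqI[of _ _ 0]) (simp_all add: vec_eq_iff)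
  then have "?T * ?z \<in> quasitorus_act X ?a (orbit (N_C Q X) ?z)"
    using orbit_refl[OF mult_subgroup_N] unfolding quasitorus_act_def by blast
  also have "\<dots> = orbit (N_C Q X) ?z"
    by (rule fixed) (auto simp: quasitorus_def)
  finally obtain g where g: "g \<in> N_C Q X" "?T * ?z = g * ?z"
    by (auto simp: mem_orbit_iff)
  then have nth: "exp2pi (axis i \<i> $ j) * ?z $ j = g $ j * ?z $ j" for j
    by (simp add: vec_eq_iff)
  have "g $ j = 1" if "j \<notin> I" for j
    using nth[of j] that i by (cases "j = i") (simp_all add: axis_def)
  then have "g \<in> Gamma_on I"
    using g(1) by (simp add: Gamma_on_eq[OF I])
  then obtain x :: "real ^ 'd" where "g = torus_exp (complexify x)"
    by (auto simp: Gamma_on_def)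
  then have "exp2pi \<i> = exp2pi (complex_of_real (x $ i))"
    using nth[of i] wi i by (simp add: axis_def)
  then have "norm (exp2pi \<i>) = norm (exp2pi (complex_of_real (x $ i)))"
    by simp
  then show False
    by (simp add: exp2pi_def norm_exp_eq_Re)
qed

text \<open>Elements of N have no zero coordinate, so all points of an orbit vanish at the same
  indices.\<close>

lemma orbit_ext_one_0_inj:
  assumes "orbit (N_C Q X) (ext_one I 0) = orbit (N_C Q X) (ext_one J 0)"
  shows "I = J"
proof -
  obtain g where "g \<in> N_C Q X" "ext_one I 0 = g * ext_one J 0"
    using assms unfolding orbit_eq_iff[OF mult_subgroup_N] by blast
  then have "ext_one I 0 $ j = 0 \<longleftrightarrow> ext_one J 0 $ j = 0" for j
    using N_nonzero by simp
  then have "j \<in> I \<longleftrightarrow> j \<in> J" for j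
    by (metis ext_one_nth zero_index zero_neq_one)
  then show ?thesis by blast
qed

lemma fixed_class_iff:
  assumes I: "basis_on X I" and c: "c \<in> V_on I"
  shows "(\<forall>a\<in>quasitorus Q. quasitorus_act X a c = c) \<longleftrightarrow> c = orbit (N_C Q X) (ext_one I 0)"
proof
  have "c \<in> eta_on I ` orbit_set (coord_subspace I) (Gamma_on I)"
    using c bij_betw_imp_surj_on[OF bij_betw_eta_on[OF I]] by simp
  then obtain w where w: "w \<in> coord_subspace I" "c = orbit (N_C Q X) (ext_one I w)"
    by (auto simp: orbit_set_def eta_on_orbit[OF I])
  assume "\<forall>a\<in>quasitorus Q. quasitorus_act X a c = c"
  then show "c = orbit (N_C Q X) (ext_one I 0)"
    using fixed_point_coordinates_zero[OF I w(1)] w(2) by simp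
qed (simp add: quasitorus_act_fixed_point[OF I])

end

section \<open>Maximal cones of a simplicial fan\<close>

lemma mem_convex_cone_hull_image:
  assumes "v \<in> convex_cone hull (X ` I)"
  obtains x where "x \<in> coord_subspace I" "\<And>j. 0 \<le> x $ j" "v = pi_real X x"
proof -
  let ?C = "pi_real X ` {x \<in> coord_subspace I. \<forall>j. 0 \<le> x $ j}"
  have add: "pi_real X (x + y) = pi_real X x + pi_real X y" for x y
    by (simp add: pi_real_def scaleR_add_left sum.distrib)
  have scale: "pi_real X (c *\<^sub>R x) = c *\<^sub>R pi_real X x" for c x
    by (simp add: pi_real_def scaleR_sum_right)
  have "convex_cone ?C"
    unfolding convex_cone_iff
  proof (intro conjI ballI allI impI)
    show "0 \<in> ?C"
      by (rule image_eqI[of _ _ 0]) (simp_all add: coord_subspace_iff)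
    show "u + v \<in> ?C" if "u \<in> ?C" "v \<in> ?C" for u v
      using that by (auto simp: coord_subspace_iff simp flip: add)
    show "c *\<^sub>R u \<in> ?C" if "u \<in> ?C" "0 \<le> c" for u c
      using that by (auto simp: coord_subspace_iff simp flip: scale)
  qed
  moreover have "X ` I \<subseteq> ?C"
  proof
    fix u assume "u \<in> X ` I"
    then obtain i where i: "i \<in> I" "u = X i" by blast
    have "pi_real X (axis i 1) = X i"
    proof -
      have "pi_real X (axis i 1) = (\<Sum>j\<in>UNIV. if j = i then X i else 0)"
        unfolding pi_real_def by (intro sum.cong) (auto simp: axis_def)
      then show ?thesis by simp
    qed
    then show "u \<in> ?C"
      using i by (intro image_eqI[of _ _ "axis i 1"]) (auto simp: coord_subspace_iff axis_def)
  qed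
  ultimately have "convex_cone hull (X ` I) \<subseteq> ?C"
    by (intro hull_minimal) simp_all
  then show thesis
    using assms that by auto
qed

lemma convex_cone_hull_singleton: "convex_cone hull {v} = {c *\<^sub>R v | c. 0 \<le> c}"
proof (rule hull_unique)
  show "convex_cone {c *\<^sub>R v | c. 0 \<le> c}"
    unfolding convex_cone_iff
  proof (intro conjI ballI allI impI)
    show "0 \<in> {c *\<^sub>R v | c. 0 \<le> c}"
      by (auto intro: exI[of _ 0])
    show "x + y \<in> {c *\<^sub>R v | c. 0 \<le> c}" if "x \<in> {c *\<^sub>R v | c. 0 \<le> c}" "y \<in> {c *\<^sub>R v | c. 0 \<le> c}" for x y
      using that by (auto simp flip: scaleR_add_left)
    show "b *\<^sub>R x \<in> {c *\<^sub>R v | c. 0 \<le> c}" if "x \<in> {c *\<^sub>R v | c. 0 \<le> c}" "0 \<le> b" for x b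
      using that by auto
  qed
  show "{v} \<subseteq> {c *\<^sub>R v | c. 0 \<le> c}"
    by (auto intro: exI[of _ 1])
qed (auto intro: convex_cone_scaleR)

lemma convex_cone_hull_singleton_eqI:
  assumes "0 < c"
  shows "convex_cone hull {c *\<^sub>R v} = convex_cone hull {v}"
proof (intro equalityI hull_minimal convex_cone_convex_cone_hull)
  show "{c *\<^sub>R v} \<subseteq> convex_cone hull {v}"
    using assms by (auto simp: convex_cone_hull_singleton intro: exI[of _ c])
  show "{v} \<subseteq> convex_cone hull {c *\<^sub>R v}"
    using assms by (auto simp: convex_cone_hull_singleton intro!: exI[of _ "inverse c"])
qed

lemma span_convex_cone_hull: "span (convex_cone hull B) = span B"
proof
  have "convex_cone hull B \<subseteq> span B"
    by (intro hull_minimal span_superset)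
      (simp add: convex_cone_iff span_add span_scale span_zero)
  then show "span (convex_cone hull B) \<subseteq> span B"
    by (simp add: span_minimal)
  show "span B \<subseteq> span (convex_cone hull B)"
    by (intro span_mono hull_subset)
qed

lemma aff_dim_convex_cone_hull: "aff_dim (convex_cone hull B) = int (dim B)"
  for B :: "'a::euclidean_space set"
proof -
  have "0 \<in> affine hull (convex_cone hull B)"
    by (intro hull_inc convex_cone_hull_contains_0)
  then have "aff_dim (convex_cone hull B) = int (dim (convex_cone hull B))"
    by (rule aff_dim_zero)
  also have "dim (convex_cone hull B) = dim B"
    using dim_span[of "convex_cone hull B"] dim_span[of B] by (simp add: span_convex_cone_hull)
  finally show ?thesis .
qed

lemma basis_onI:
  fixes X :: "'d::finite \<Rightarrow> real ^ 'n"
  assumes card: "card I = CARD('n)" and dim: "dim (X ` I) = CARD('n)"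
  shows "basis_on X I"
proof -
  have card_image: "card (X ` I) = card I"
    using dim dim_le_card'[of "X ` I"] card_image_le[of I X] card by simp
  then have inj: "inj_on X I"
    by (simp add: eq_card_imp_inj_on)
  have span: "span (X ` I) = UNIV"
    using dim dim_eq_full[of "X ` I"] by simp
  have indep: "independent (X ` I)"
    using card_eq_dim[of "X ` I" UNIV] card_image card span by simp
  have restrict: "pi_real X x = (\<Sum>i\<in>I. x $ i *\<^sub>R X i)" if "x \<in> coord_subspace I" for x
    unfolding pi_real_def
    by (rule sum.mono_neutral_right) (use that coord_subspaceD in auto)
  show ?thesis
    unfolding basis_on_def bij_betw_def
  proof
    show "inj_on (pi_real X) (coord_subspace I)"
    proof (rule inj_onI)
      fix x y assume x: "x \<in> coord_subspace I" and y: "y \<in> coord_subspace I"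
        and eq: "pi_real X x = pi_real X y"
      \<comment> \<open>Independence concerns sets of vectors, so coefficients indexed by
        \<open>I\<close> are transported to vectors through the inverse of \<open>X\<close> on
        \<open>I\<close>.\<close>
      define u where "u v = x $ (the_inv_into I X v) - y $ (the_inv_into I X v)" for v
      have "(\<Sum>v\<in>X ` I. u v *\<^sub>R v) = (\<Sum>i\<in>I. (x $ i - y $ i) *\<^sub>R X i)"
        by (simp add: sum.reindex[OF inj] u_def the_inv_into_f_f[OF inj])
      also have "\<dots> = 0"
        using eq by (simp add: restrict x y scaleR_diff_left sum_subtractf)
      finally have u_0: "u v = 0" if "v \<in> X ` I" for v
        using independentD[OF indep _ order.refl _ that] by simp
      then have "x $ i = y $ i" if "i \<in> I" for i
        using that u_0[of "X i"] by (simp add: u_def the_inv_into_f_f[OF inj])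
      moreover have "x $ i = y $ i" if "i \<notin> I" for i
        using coord_subspaceD[OF x that] coord_subspaceD[OF y that] by simp
      ultimately show "x = y"
        unfolding vec_eq_iff by blast
    qed
    have "y \<in> pi_real X ` coord_subspace I" for y
    proof -
      have "y \<in> span (X ` I)" by (simp add: span)
      then obtain u where "y = (\<Sum>v\<in>X ` I. u v *\<^sub>R v)"
        using span_finite[of "X ` I"] by auto
      then have y: "y = (\<Sum>i\<in>I. u (X i) *\<^sub>R X i)"
        by (simp add: sum.reindex[OF inj])
      show ?thesis
      proof (rule image_eqI)
        show x: "(\<chi> j. if j \<in> I then u (X j) else 0) \<in> coord_subspace I"
          by (simp add: coord_subspace_iff)
        show "y = pi_real X (\<chi> j. if j \<in> I then u (X j) else 0)"
          unfolding restrict[OF x] y by simp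
      qed
    qed
    then show "pi_real X ` coord_subspace I = UNIV" by blast
  qed
qed

section \<open>Uniqueness and existence of the index set of a maximal cone\<close>

lemma ray_generator_nonzero:
  assumes "ray_generators \<Sigma> X"
  shows "X j \<noteq> 0"
proof
  assume "X j = 0"
  then have "convex_cone hull {X j} = {0}"
    by (auto simp: convex_cone_hull_singleton)
  moreover have "convex_cone hull {X j} \<in> rays \<Sigma>"
    using assms by (auto simp: ray_generators_def bij_betw_def)
  ultimately show False
    by (simp add: rays_def)
qed

text \<open>
  A generator in the cone spans one of its faces, and the only one-dimensional faces of a
  simplicial cone are those spanned by its own generators.
\<close>

lemma spanning_indices_eq:
  fixes X :: "'d::finite \<Rightarrow> real ^ 'n"
  assumes fan: "fan \<Sigma>" and X: "ray_generators \<Sigma> X"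
    and \<sigma>: "\<sigma> \<in> \<Sigma>" "\<sigma> = convex_cone hull (X ` I)"
  shows "I = {j. X j \<in> \<sigma>}"
proof (intro equalityI subsetI CollectI)
  fix j assume "j \<in> I"
  then show "X j \<in> \<sigma>"
    by (simp add: \<sigma>(2) hull_inc)
next
  fix j assume "j \<in> {j. X j \<in> \<sigma>}"
  then have j: "X j \<in> \<sigma>" by simp
  let ?F = "convex_cone hull {X j}"
  have cone: "convex_cone \<sigma>"
    unfolding \<sigma>(2) by (rule convex_cone_convex_cone_hull)
  have "?F \<in> \<Sigma>"
    using X by (auto simp: ray_generators_def bij_betw_def rays_def)
  then have "(\<sigma> \<inter> ?F) face_of \<sigma>"
    using fan \<sigma>(1) by (simp add: fan_def)
  moreover have "?F \<subseteq> \<sigma>"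
    using j cone by (intro hull_minimal) simp_all
  ultimately have face: "?F face_of \<sigma>"
    by (simp add: Int_absorb1)
  obtain x where x: "x \<in> coord_subspace I" "\<And>j. 0 \<le> x $ j" "X j = pi_real X x"
    using mem_convex_cone_hull_image[OF j[unfolded \<sigma>(2)]] by metis
  have "x \<noteq> 0"
    using x(3) ray_generator_nonzero[OF X, of j] by auto
  then obtain i where "x $ i \<noteq> 0"
    by (auto simp: vec_eq_iff)
  then have xi: "0 < x $ i" and i: "i \<in> I"
    using x(2)[of i] coord_subspaceD[OF x(1)] by (simp, blast)
  \<comment> \<open>Split X_j into the contribution of one generator with positive coefficient and
    the rest. The factors 2 make X_j the midpoint of \<open>a\<close> and \<open>b\<close>, so that
    the face property puts \<open>a\<close> on the ray of X_j.\<close>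
  define a where "a = (2 * x $ i) *\<^sub>R X i"
  define b where "b = 2 *\<^sub>R (\<Sum>k\<in>UNIV - {i}. x $ k *\<^sub>R X k)"
  have gen: "c *\<^sub>R X k \<in> \<sigma>" if "k \<in> I" "0 \<le> c" for c k
    using that cone by (simp add: \<sigma>(2) hull_inc convex_cone_scaleR)
  have a: "a \<in> \<sigma>"
    unfolding a_def using gen[OF i] xi by simp
  have sum: "(\<Sum>k\<in>A. x $ k *\<^sub>R X k) \<in> \<sigma>" for A
  proof (induction A rule: infinite_finite_induct)
    case (insert k A)
    have "x $ k *\<^sub>R X k \<in> \<sigma>"
      using gen[of k "x $ k"] x(2)[of k] coord_subspaceD[OF x(1), of k] cone
      by (cases "k \<in> I") (auto simp: convex_cone_iff)
    with insert show ?case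
      using cone by (simp add: convex_cone_add)
  qed (use cone in \<open>simp_all add: convex_cone_iff\<close>)
  have b: "b \<in> \<sigma>"
    unfolding b_def using cone sum by (intro convex_cone_scaleR) simp_all
  have mid: "X j = midpoint a b"
  proof -
    have "X j = x $ i *\<^sub>R X i + (\<Sum>k\<in>UNIV - {i}. x $ k *\<^sub>R X k)"
      using x(3) by (simp add: pi_real_def sum.remove[of UNIV i])
    then show ?thesis
      by (simp add: midpoint_def a_def b_def scaleR_add_right)
  qed
  have "a \<in> ?F"
  \<comment> \<open>The open segment is empty if the endpoints coincide, but then X_j equals
    \<open>a\<close>.\<close>
  proof (cases "a = b")
    case True
    then have "X j = a" using mid by simp
    then show ?thesis by (simp add: hull_inc)
  next
    case False
    then have "X j \<in> open_segment a b"
      using mid by simp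
    then show ?thesis
      using face a b hull_inc[of "X j" "{X j}"] by (meson face_ofD insertI1)
  qed
  then obtain c where c: "0 \<le> c" "(2 * x $ i) *\<^sub>R X i = c *\<^sub>R X j"
    by (auto simp: a_def convex_cone_hull_singleton)
  have "c \<noteq> 0"
    using c(2) xi ray_generator_nonzero[OF X, of i] by auto
  then have "convex_cone hull {X i} = convex_cone hull {X j}"
    using convex_cone_hull_singleton_eqI[of "2 * x $ i" "X i"]
      convex_cone_hull_singleton_eqI[of c "X j"] c xi by simp
  then have "i = j"
    using X by (auto simp: ray_generators_def bij_betw_def dest: injD)
  with i show "j \<in> I" by simp
qed

text \<open>The generators supplied by simpliciality may differ from the X_j by positive factors.
  Both families are compared through the rays they span: distinct elements of \<open>B\<close> span
  distinct rays by independence, so \<open>I\<close> and \<open>B\<close> have equal size.\<close>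

lemma spanning_indices_exist:
  fixes X :: "'d::finite \<Rightarrow> real ^ 'n"
  assumes X: "ray_generators \<Sigma> X" and simplicial: "simplicial_fan \<Sigma>"
    and \<sigma>: "\<sigma> \<in> maximal_cones \<Sigma>"
  shows "\<exists>I. card I = CARD('n) \<and> \<sigma> = convex_cone hull (X ` I)"
proof -
  let ?ray = "\<lambda>v :: real ^ 'n. convex_cone hull {v}"
  obtain B where B: "independent B" "\<And>b. b \<in> B \<Longrightarrow> ?ray b \<in> rays \<Sigma>" "\<sigma> = convex_cone hull B"
  proof -
    have "\<sigma> \<in> \<Sigma>"
      using \<sigma> by (simp add: maximal_cones_def)
    from simplicial[unfolded simplicial_fan_def, THEN bspec, OF this] show thesis
      using that by auto
  qed
  have bij: "bij_betw (\<lambda>j. ?ray (X j)) UNIV (rays \<Sigma>)"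
    using X by (simp add: ray_generators_def)
  define I where "I = {j. ?ray (X j) \<in> ?ray ` B}"
  have "inj_on (\<lambda>j. ?ray (X j)) I"
    using bij by (auto simp: bij_betw_def intro: inj_on_subset)
  moreover have image: "(\<lambda>j. ?ray (X j)) ` I = ?ray ` B"
  proof -
    have "?ray ` B \<subseteq> range (\<lambda>j. ?ray (X j))"
      using B(2) bij by (auto simp: bij_betw_def)
    then have "(\<lambda>j. ?ray (X j)) ` ((\<lambda>j. ?ray (X j)) -` (?ray ` B)) = ?ray ` B"
      unfolding image_vimage_eq by (rule Int_absorb2)
    then show ?thesis
      unfolding I_def vimage_def .
  qed
  moreover have "inj_on ?ray B"
  proof (rule inj_onI, rule ccontr)
    fix b b' assume b: "b \<in> B" "b' \<in> B" "?ray b = ?ray b'" "b \<noteq> b'"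
    have "b \<in> ?ray b'"
      unfolding b(3)[symmetric] by (simp add: hull_inc)
    then have "b \<in> span {b'}"
      by (auto simp: convex_cone_hull_singleton span_singleton)
    moreover have "span {b'} \<subseteq> span (B - {b})"
      using b by (intro span_mono) auto
    ultimately show False
      using B(1) b(1) by (auto simp: dependent_def)
  qed
  ultimately have "card I = card B"
    by (metis card_image)
  moreover have "int (card B) = int CARD('n)"
  proof -
    have "aff_dim \<sigma> = int CARD('n)"
      using \<sigma> by (simp add: maximal_cones_def)
    then show ?thesis
      unfolding B(3) aff_dim_convex_cone_hull by (simp add: dim_eq_card_independent[OF B(1)])
  qed
  moreover have "\<sigma> = convex_cone hull (X ` I)"
    unfolding B(3)
  proof (intro equalityI hull_minimal convex_cone_convex_cone_hull subsetI)
    fix b assume "b \<in> B"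
    then obtain j where j: "j \<in> I" "?ray (X j) = ?ray b"
      using image by (metis (mono_tags, lifting) image_iff)
    have "b \<in> ?ray (X j)"
      unfolding j(2) by (simp add: hull_inc)
    moreover have "?ray (X j) \<subseteq> convex_cone hull (X ` I)"
      using j by (intro hull_mono) auto
    ultimately show "b \<in> convex_cone hull (X ` I)" by blast
  next
    fix v assume "v \<in> X ` I"
    then obtain j b where v: "v = X j" and b: "b \<in> B" and ray: "?ray (X j) = ?ray b"
      by (auto simp: I_def)
    have "v \<in> ?ray b"
      unfolding ray[symmetric] v by (simp add: hull_inc)
    moreover have "?ray b \<subseteq> convex_cone hull B"
      using b by (intro hull_mono) auto
    ultimately show "v \<in> convex_cone hull B" by blast
  qed
  ultimately show ?thesis by auto
qed

text \<open>Any index set spanning the cone is the set of all j with X_j in the cone. This gives the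
  uniqueness that justifies the definite description.\<close>

lemma cone_indices_maximal:
  fixes X :: "'d::finite \<Rightarrow> real ^ 'n"
  assumes fan: "fan \<Sigma>" and X: "ray_generators \<Sigma> X" and simplicial: "simplicial_fan \<Sigma>"
    and \<sigma>: "\<sigma> \<in> maximal_cones \<Sigma>"
  shows "basis_on X (cone_indices X \<sigma>)" "\<sigma> = convex_cone hull (X ` cone_indices X \<sigma>)"
proof -
  have mem: "\<sigma> \<in> \<Sigma>" and dim: "aff_dim \<sigma> = int CARD('n)"
    using \<sigma> by (simp_all add: maximal_cones_def)
  have "\<exists>!I. card I = CARD('n) \<and> \<sigma> = convex_cone hull (X ` I)"
    using spanning_indices_exist[OF X simplicial \<sigma>] spanning_indices_eq[OF fan X mem] by metis
  then have *: "card (cone_indices X \<sigma>) = CARD('n) \<and> \<sigma> = convex_cone hull (X ` cone_indices X \<sigma>)"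
    unfolding cone_indices_def by (rule theI')
  then show "\<sigma> = convex_cone hull (X ` cone_indices X \<sigma>)" by simp
  then have "int (dim (X ` cone_indices X \<sigma>)) = int CARD('n)"
    using dim aff_dim_convex_cone_hull by metis
  then show "basis_on X (cone_indices X \<sigma>)"
    using * by (intro basis_onI) simp_all
qed

lemma quasilattice_vectorsI:
  assumes "quasilattice Q" "\<And>j. X j \<in> Q"
  shows "quasilattice_vectors Q X"
proof
  obtain A where Q: "Q = group_closure A"
    using assms(1) by (auto simp: quasilattice_def)
  show "0 \<in> Q" by (simp add: Q)
  show "p - q \<in> Q" if "p \<in> Q" "q \<in> Q" for p q
    using that group_closure.diff by (simp add: Q)
qed (rule assms(2))

theorem theorem2p4:
  fixes \<Sigma> :: "(real ^ 'n) set set"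
    and Q :: "(real ^ 'n) set"
    and X :: "'d::finite \<Rightarrow> real ^ 'n"
  assumes triple: "fundamental_triple \<Sigma> Q X"
    and simplicial: "simplicial_fan \<Sigma>"
    and convex_support: "convex (support \<Sigma>)"
    and full_dim: "aff_dim (support \<Sigma>) = int CARD('n)"
  shows "quasifold_atlas (toric_quasifold \<Sigma> Q X) (canonical_chart Q X ` maximal_cones \<Sigma>) \<and>
         bij_betw (p_point Q X) (maximal_cones \<Sigma>) (fixed_points \<Sigma> Q X) \<and>
         (\<forall>\<sigma>\<in>maximal_cones \<Sigma>.
           p_point Q X \<sigma> = eta_cone Q X \<sigma> (orbit (Gamma_cone Q X \<sigma>) 0) \<and>
           p_point Q X \<sigma> \<in> V_cone Q X \<sigma>) \<and>
         (\<forall>\<sigma>\<in>maximal_cones \<Sigma>. \<forall>\<tau>\<in>maximal_cones \<Sigma>.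
           V_cone Q X \<sigma> \<inter> V_cone Q X \<tau> \<noteq> {} \<longrightarrow>
           (let I = cone_indices X \<sigma>; J = cone_indices X \<tau> in
            \<exists>a :: 'd \<Rightarrow> real ^ 'd. (\<forall>j\<in>J - I. a j \<in> Q_cone Q X \<sigma>) \<and>
              (\<forall>z\<in>chart_preimage (canonical_chart Q X \<tau>) (V_cone Q X \<sigma> \<inter> V_cone Q X \<tau>).
                 (\<forall>j\<in>J - I. z $ j \<noteq> 0) \<and>
                 (\<forall>\<zeta>. (\<forall>j\<in>J - I. exp2pi (\<zeta> j) = z $ j) \<longrightarrow>
                    transition (canonical_chart Q X \<sigma>) (canonical_chart Q X \<tau>)
                      (orbit (Gamma_cone Q X \<tau>) z) =
                    orbit (Gamma_cone Q X \<sigma>)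
                      (\<chi> i. if i \<in> I - J then laurent_monomial (J - I) a \<zeta> i
                            else if i \<in> I \<inter> J then z $ i * laurent_monomial (J - I) a \<zeta> i
                            else 0)))))"
proof -
  have fan: "fan \<Sigma>" and X: "ray_generators \<Sigma> X" and quasi: "quasilattice Q" "\<And>j. X j \<in> Q"
    using triple by (simp_all add: fundamental_triple_def)
  interpret quasilattice_vectors Q X
    using quasi by (rule quasilattice_vectorsI)
  let ?M = "maximal_cones \<Sigma>" and ?I = "cone_indices X" and ?T = "toric_quasifold \<Sigma> Q X"
  note basis = cone_indices_maximal(1)[OF fan X simplicial]
    and cone_eq = cone_indices_maximal(2)[OF fan X simplicial]
  \<comment> \<open>The notions attached to cones are first identified with their versions for index
    sets.\<close>
  have U: "U_cone X \<sigma> = punctured UNIV (- ?I \<sigma>)" for \<sigma>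
    by (auto simp: U_cone_def punctured_def coord_subspace_iff)
  have Gamma: "Gamma_cone Q X \<sigma> = Gamma_on (?I \<sigma>)" for \<sigma>
    by (simp add: Gamma_cone_def Gamma_on_def Q_cone_def)
  have V: "V_cone Q X \<sigma> = V_on (?I \<sigma>)" for \<sigma>
    by (simp add: V_cone_def V_on_def U)
  have eta: "eta_cone Q X \<sigma> = eta_on (?I \<sigma>)" for \<sigma>
    by (rule ext) (simp add: eta_cone_def eta_on_def ext_one_def)
  have chart: "canonical_chart Q X \<sigma> = chart_on (?I \<sigma>)" for \<sigma>
    by (simp add: canonical_chart_def chart_on_def Gamma V eta)
  have p: "p_point Q X \<sigma> = orbit (N_C Q X) (ext_one (?I \<sigma>) 0)" for \<sigma>
    unfolding p_point_def by (rule arg_cong[where f = "orbit (N_C Q X)"]) (simp add: vec_eq_iff)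
  have U_fan: "U_fan \<Sigma> X = (\<Union>\<sigma>\<in>?M. punctured UNIV (- ?I \<sigma>))"
    by (simp add: U_fan_def U)
  have open_U: "open (U_fan \<Sigma> X)"
    unfolding U_fan by (intro open_UN ballI open_punctured_UNIV)
  have sub: "punctured UNIV (- ?I \<sigma>) \<subseteq> U_fan \<Sigma> X" if "\<sigma> \<in> ?M" for \<sigma>
    using that unfolding U_fan by blast
  have top: "topspace ?T = (\<Union>\<sigma>\<in>?M. V_on (?I \<sigma>))"
    by (auto simp: toric_quasifold_def orbit_space_def topspace_quotient_topology U_fan V_on_def
        orbit_set_def)

  have "quasifold_atlas ?T (canonical_chart Q X ` ?M)"
    unfolding quasifold_atlas_def
  proof (intro conjI)
    show "\<forall>(M, G, V, \<eta>)\<in>canonical_chart Q X ` ?M.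
        openin ?T V \<and> homeomorphic_map (orbit_space M G) (subtopology ?T V) \<eta>"
      using openin_V_on[OF open_U sub] homeomorphic_map_eta_on[OF basis open_U sub]
      by (auto simp: chart chart_on_def toric_quasifold_def)
    show "(\<Union>(M, G, V, \<eta>)\<in>canonical_chart Q X ` ?M. V) = topspace ?T"
      unfolding top by (simp add: chart chart_on_def)
    show "\<forall>c'\<in>canonical_chart Q X ` ?M. \<forall>c\<in>canonical_chart Q X ` ?M. compatible c' c"
      using compatible_charts[OF basis basis] by (auto simp: chart)
  qed
  moreover have "bij_betw (p_point Q X) ?M (fixed_points \<Sigma> Q X)"
    unfolding bij_betw_def
  proof
    show "inj_on (p_point Q X) ?M"
    proof (rule inj_onI)
      fix \<sigma> \<tau> assume "\<sigma> \<in> ?M" "\<tau> \<in> ?M" "p_point Q X \<sigma> = p_point Q X \<tau>"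
      \<comment> \<open>Equal points have equal index sets, and a maximal cone is recovered from its
        generators.\<close>
      then show "\<sigma> = \<tau>"
        using orbit_ext_one_0_inj[of "?I \<sigma>" "?I \<tau>"] cone_eq[of \<sigma>] cone_eq[of \<tau>] unfolding p by simp
    qed
    have "p_point Q X \<sigma> \<in> V_on (?I \<sigma>)" for \<sigma>
      by (simp add: p orbit_mem_V_on_iff ext_one_mem_punctured)
    then show "p_point Q X ` ?M = fixed_points \<Sigma> Q X"
      unfolding fixed_points_def top using fixed_class_iff[OF basis] p by blast
  qed
  moreover have "p_point Q X \<sigma> = eta_cone Q X \<sigma> (orbit (Gamma_cone Q X \<sigma>) 0) \<and>
      p_point Q X \<sigma> \<in> V_cone Q X \<sigma>" if "\<sigma> \<in> ?M" for \<sigma>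
    using basis[OF that]
    by (simp add: p eta Gamma V eta_on_orbit orbit_mem_V_on_iff ext_one_mem_punctured)
  \<comment> \<open>The exponent vectors are the preimages of the X_j under pi_sigma, and the X_j
    belong to \<open>Q\<close>.\<close>
  moreover have "coord_rep X (?I \<sigma>) j \<in> Q_cone Q X \<sigma>" if "\<sigma> \<in> ?M" for \<sigma> j
    using basis[OF that]
    by (simp add: Q_cone_def coord_rep_mem pi_real_coord_rep vector_mem)
  moreover have "(\<forall>j\<in>?I \<tau> - ?I \<sigma>. z $ j \<noteq> 0) \<and>
      (\<forall>\<zeta>. (\<forall>j\<in>?I \<tau> - ?I \<sigma>. exp2pi (\<zeta> j) = z $ j) \<longrightarrow>
        transition (canonical_chart Q X \<sigma>) (canonical_chart Q X \<tau>) (orbit (Gamma_cone Q X \<tau>) z) =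
        orbit (Gamma_cone Q X \<sigma>)
          (\<chi> i. if i \<in> ?I \<sigma> - ?I \<tau> then laurent_monomial (?I \<tau> - ?I \<sigma>) (coord_rep X (?I \<sigma>)) \<zeta> i
                else if i \<in> ?I \<sigma> \<inter> ?I \<tau>
                then z $ i * laurent_monomial (?I \<tau> - ?I \<sigma>) (coord_rep X (?I \<sigma>)) \<zeta> i
                else 0))"
    if "\<sigma> \<in> ?M" "\<tau> \<in> ?M"
      "z \<in> chart_preimage (canonical_chart Q X \<tau>) (V_cone Q X \<sigma> \<inter> V_cone Q X \<tau>)" for \<sigma> \<tau> z
  proof -
    have z: "z \<in> punctured (?I \<tau>) (?I \<tau> - ?I \<sigma>)"
      using that(3) unfolding chart V chart_preimage_eq[OF basis[OF that(2)]] .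
    then show ?thesis
      using transition_laurent[OF basis[OF that(1)] basis[OF that(2)] z]
      unfolding chart Gamma by (simp add: punctured_def)
  qed
  ultimately show ?thesis
    unfolding Let_def by blast
qed

end
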